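(* Let $\mathfrak{g}$ be a quadratic Lie algebra over $\mathbb{F}$ with invariant metric $B$, and let $\mathcal{S}$ be an associative and commutative algebra with unit over $\mathbb{F}$. The current Lie algebra $\mathfrak{g}\otimes\mathcal{S}$ admits an invariant metric if and only if there exists a bilinear map $\alpha:\mathcal{S}\times\mathcal{S}\to\Gamma(\mathfrak{g})$ satisfying: (i) $\alpha(s,t)(x)=\alpha(st,1)(x)$ for all $x\in[\mathfrak{g},\mathfrak{g}]$ and all $s,t\in\mathcal{S}$; (ii) $\bigcap_{s\in\mathcal{S}}\operatorname{Ker}(\mathcal{F}(s))=\{0\}$, where $\mathcal{F}(s):\mathfrak{g}\otimes\mathcal{S}\to\mathfrak{g}$ is the linear map defined by $\mathcal{F}(s)(x\otimes t)=\alpha(s,t)(x)$ for all $x\in\mathfrak{g}$ and $s,t\in\mathcal{S}$; (iii) $\alpha(s,t)^{\ast}=\alpha(t,s)$ for all $s,t\in\mathcal{S}$, where $\alpha(s,t)^{\ast}$ is the $B$-adjoint of $\alpha(s,t)$, that is, $B(\alpha(s,t)(x),y)=B(x,\alpha(s,t)^{\ast}(y))$ for all $x,y\in\mathfrak{g}$.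
   Context: All algebras and vector spaces are finite-dimensional over a field $\mathbb{F}$ of characteristic zero. An invariant metric on a Lie algebra $\mathfrak{g}$ is a non-degenerate, symmetric bilinear form $B:\mathfrak{g}\times\mathfrak{g}\to\mathbb{F}$ with $B(x,[y,z])=B([x,y],z)$ for all $x,y,z$; a quadratic Lie algebra is a Lie algebra equipped with an invariant metric. The current Lie algebra of $\mathfrak{g}$ by $\mathcal{S}$ is the vector space $\mathfrak{g}\otimes\mathcal{S}$ (tensor product over $\mathbb{F}$) with bracket $[x\otimes s,y\otimes t]=[x,y]\otimes st$. A centroid of $\mathfrak{g}$ is a linear map $T:\mathfrak{g}\to\mathfrak{g}$ with $T([x,y])=[T(x),y]$ for all $x,y\in\mathfrak{g}$; $\Gamma(\mathfrak{g})$ denotes the vector space of centroids of $\mathfrak{g}$. *)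

theory Defs
  imports "HOL-Algebra.Module" "HOL-Algebra.AbelCoset"
begin

text \<open>
  Vector spaces over a field \<open>K\<close> are modules over \<open>K\<close> in the sense of HOL-Algebra; only the
  \<open>carrier\<close>, \<open>add\<close>, \<open>zero\<close> and \<open>smult\<close> components are relevant for them.
\<close>

definition linear_map ::
    "('k, 'r) ring_scheme \<Rightarrow> ('k, 'v, 'm) module_scheme \<Rightarrow> ('k, 'w, 'n) module_scheme
      \<Rightarrow> ('v \<Rightarrow> 'w) \<Rightarrow> bool"
  where "linear_map K V W h \<longleftrightarrow>
    h \<in> carrier V \<rightarrow> carrier W \<and>
    (\<forall>x\<in>carrier V. \<forall>y\<in>carrier V. h (x \<oplus>\<^bsub>V\<^esub> y) = h x \<oplus>\<^bsub>W\<^esub> h y) \<and>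
    (\<forall>a\<in>carrier K. \<forall>x\<in>carrier V. h (a \<odot>\<^bsub>V\<^esub> x) = a \<odot>\<^bsub>W\<^esub> h x)"

definition bilinear_map ::
    "('k, 'r) ring_scheme \<Rightarrow> ('k, 'u, 'l) module_scheme \<Rightarrow> ('k, 'v, 'm) module_scheme
      \<Rightarrow> ('k, 'w, 'n) module_scheme \<Rightarrow> ('u \<Rightarrow> 'v \<Rightarrow> 'w) \<Rightarrow> bool"
  where "bilinear_map K U V W f \<longleftrightarrow>
    (\<forall>x\<in>carrier U. linear_map K V W (f x)) \<and>
    (\<forall>y\<in>carrier V. linear_map K U W (\<lambda>x. f x y))"

definition self_module :: "('k, 'r) ring_scheme \<Rightarrow> ('k, 'k) module"
  where "self_module K =
    \<lparr>carrier = carrier K, mult = mult K, one = one K, zero = zero K, add = add K,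
     smult = mult K\<rparr>"

definition module_span ::
    "('k, 'r) ring_scheme \<Rightarrow> ('k, 'v, 'm) module_scheme \<Rightarrow> 'v set \<Rightarrow> 'v set"
  where "module_span K V A = \<Inter>{H. submodule H K V \<and> A \<subseteq> H}"

definition finite_dimensional ::
    "('k, 'r) ring_scheme \<Rightarrow> ('k, 'v, 'm) module_scheme \<Rightarrow> bool"
  where "finite_dimensional K V \<longleftrightarrow>
    (\<exists>A. finite A \<and> A \<subseteq> carrier V \<and> module_span K V A = carrier V)"

definition characteristic_zero :: "('k, 'r) ring_scheme \<Rightarrow> bool"
  where "characteristic_zero K \<longleftrightarrow> (\<forall>n::nat. n > 0 \<longrightarrow> [n] \<cdot>\<^bsub>K\<^esub> \<one>\<^bsub>K\<^esub> \<noteq> \<zero>\<^bsub>K\<^esub>)"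


section \<open>Tensor products of vector spaces\<close>

text \<open>
  The components \<open>mult\<close> and \<open>one\<close> of the modules defined below carry no meaning and are left
  \<open>undefined\<close>. The free module on \<open>A\<close> consists of the finitely supported functions vanishing
  outside \<open>A\<close>.
\<close>

definition free_module :: "('k, 'r) ring_scheme \<Rightarrow> 'a set \<Rightarrow> ('k, 'a \<Rightarrow> 'k) module"
  where "free_module K A =
    \<lparr>carrier = {f. range f \<subseteq> carrier K \<and> finite {p. f p \<noteq> \<zero>\<^bsub>K\<^esub>} \<and> {p. f p \<noteq> \<zero>\<^bsub>K\<^esub>} \<subseteq> A},
     mult = undefined, one = undefined,
     zero = (\<lambda>p. \<zero>\<^bsub>K\<^esub>), add = (\<lambda>f g p. f p \<oplus>\<^bsub>K\<^esub> g p),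
     smult = (\<lambda>a f p. a \<otimes>\<^bsub>K\<^esub> f p)\<rparr>"

definition free_gen :: "('k, 'r) ring_scheme \<Rightarrow> 'a \<Rightarrow> 'a \<Rightarrow> 'k"
  where "free_gen K p = (\<lambda>q. if q = p then \<one>\<^bsub>K\<^esub> else \<zero>\<^bsub>K\<^esub>)"

definition quotient_module ::
    "('k, 'v, 'm) module_scheme \<Rightarrow> 'v set \<Rightarrow> ('k, 'v set) module"
  where "quotient_module V N =
    \<lparr>carrier = a_rcosets\<^bsub>V\<^esub> N, mult = undefined, one = undefined,
     zero = N, add = set_add V, smult = (\<lambda>a C. \<Union>v\<in>C. N +>\<^bsub>V\<^esub> (a \<odot>\<^bsub>V\<^esub> v))\<rparr>"

definition tensor_relations ::
    "('k, 'r) ring_scheme \<Rightarrow> ('k, 'v, 'm) module_scheme \<Rightarrow> ('k, 'w, 'n) module_scheme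
      \<Rightarrow> ('v \<times> 'w \<Rightarrow> 'k) set"
  where "tensor_relations K V W =
    (let F = free_module K (carrier V \<times> carrier W); e = (\<lambda>x y. free_gen K (x, y)) in
      {e (x \<oplus>\<^bsub>V\<^esub> x') y \<ominus>\<^bsub>F\<^esub> (e x y \<oplus>\<^bsub>F\<^esub> e x' y) | x x' y.
        x \<in> carrier V \<and> x' \<in> carrier V \<and> y \<in> carrier W} \<union>
      {e x (y \<oplus>\<^bsub>W\<^esub> y') \<ominus>\<^bsub>F\<^esub> (e x y \<oplus>\<^bsub>F\<^esub> e x y') | x y y'.
        x \<in> carrier V \<and> y \<in> carrier W \<and> y' \<in> carrier W} \<union>
      {e (a \<odot>\<^bsub>V\<^esub> x) y \<ominus>\<^bsub>F\<^esub> (a \<odot>\<^bsub>F\<^esub> e x y) | a x y.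
        a \<in> carrier K \<and> x \<in> carrier V \<and> y \<in> carrier W} \<union>
      {e x (a \<odot>\<^bsub>W\<^esub> y) \<ominus>\<^bsub>F\<^esub> (a \<odot>\<^bsub>F\<^esub> e x y) | a x y.
        a \<in> carrier K \<and> x \<in> carrier V \<and> y \<in> carrier W})"

definition tensor_kernel ::
    "('k, 'r) ring_scheme \<Rightarrow> ('k, 'v, 'm) module_scheme \<Rightarrow> ('k, 'w, 'n) module_scheme
      \<Rightarrow> ('v \<times> 'w \<Rightarrow> 'k) set"
  where "tensor_kernel K V W =
    module_span K (free_module K (carrier V \<times> carrier W)) (tensor_relations K V W)"

definition tensor_product ::
    "('k, 'r) ring_scheme \<Rightarrow> ('k, 'v, 'm) module_scheme \<Rightarrow> ('k, 'w, 'n) module_scheme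
      \<Rightarrow> ('k, ('v \<times> 'w \<Rightarrow> 'k) set) module"
  where "tensor_product K V W =
    quotient_module (free_module K (carrier V \<times> carrier W)) (tensor_kernel K V W)"

definition pure_tensor ::
    "('k, 'r) ring_scheme \<Rightarrow> ('k, 'v, 'm) module_scheme \<Rightarrow> ('k, 'w, 'n) module_scheme
      \<Rightarrow> 'v \<Rightarrow> 'w \<Rightarrow> ('v \<times> 'w \<Rightarrow> 'k) set"
  where "pure_tensor K V W x y =
    tensor_kernel K V W +>\<^bsub>free_module K (carrier V \<times> carrier W)\<^esub> free_gen K (x, y)"

text \<open>
  For a bilinear map \<open>f\<close> on \<open>V \<times> W\<close> with values in \<open>U\<close>, \<open>tensor_lift K U f\<close> is the linear map
  from the tensor product of \<open>V\<close> and \<open>W\<close> to \<open>U\<close> sending the pure tensor of \<open>x\<close> and \<open>y\<close> to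
  \<open>f x y\<close>: the sum below is the linear extension of \<open>f\<close> to the free module, and by bilinearity
  it takes the same value at all representatives \<open>c\<close> of a coset \<open>u\<close>.
\<close>

definition tensor_lift ::
    "('k, 'r) ring_scheme \<Rightarrow> ('k, 'u, 'l) module_scheme \<Rightarrow> ('v \<Rightarrow> 'w \<Rightarrow> 'u)
      \<Rightarrow> ('v \<times> 'w \<Rightarrow> 'k) set \<Rightarrow> 'u"
  where "tensor_lift K U f u =
    the_elem ((\<lambda>c. \<Oplus>\<^bsub>U\<^esub>p\<in>{p. c p \<noteq> \<zero>\<^bsub>K\<^esub>}. c p \<odot>\<^bsub>U\<^esub> f (fst p) (snd p)) ` u)"


section \<open>Quadratic Lie algebras, current Lie algebras and centroids\<close>

record ('k, 'g) lie_algebra = "('k, 'g) module" +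
  bracket :: "['g, 'g] \<Rightarrow> 'g"

locale lie_algebra = K?: field K + L?: module K L for K (structure) and L (structure) +
  assumes bracket_bilinear: "bilinear_map K L L L (bracket L)"
    and bracket_self: "x \<in> carrier L \<Longrightarrow> bracket L x x = \<zero>\<^bsub>L\<^esub>"
    and jacobi: "\<lbrakk>x \<in> carrier L; y \<in> carrier L; z \<in> carrier L\<rbrakk> \<Longrightarrow>
      bracket L x (bracket L y z) \<oplus>\<^bsub>L\<^esub> bracket L y (bracket L z x)
        \<oplus>\<^bsub>L\<^esub> bracket L z (bracket L x y) = \<zero>\<^bsub>L\<^esub>"

definition invariant_metric ::
    "('k, 'r) ring_scheme \<Rightarrow> ('k, 'g, 'l) lie_algebra_scheme \<Rightarrow> ('g \<Rightarrow> 'g \<Rightarrow> 'k) \<Rightarrow> bool"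
  where "invariant_metric K L B \<longleftrightarrow>
    bilinear_map K L L (self_module K) B \<and>
    (\<forall>x\<in>carrier L. \<forall>y\<in>carrier L. B x y = B y x) \<and>
    (\<forall>x\<in>carrier L. (\<forall>y\<in>carrier L. B x y = \<zero>\<^bsub>K\<^esub>) \<longrightarrow> x = \<zero>\<^bsub>L\<^esub>) \<and>
    (\<forall>x\<in>carrier L. \<forall>y\<in>carrier L. \<forall>z\<in>carrier L.
      B x (bracket L y z) = B (bracket L x y) z)"

locale quadratic_lie_algebra = lie_algebra +
  fixes B :: "'c \<Rightarrow> 'c \<Rightarrow> 'a"
  assumes metric: "invariant_metric K L B"

definition derived_algebra ::
    "('k, 'r) ring_scheme \<Rightarrow> ('k, 'g, 'l) lie_algebra_scheme \<Rightarrow> 'g set"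
  where "derived_algebra K L =
    module_span K L {bracket L x y | x y. x \<in> carrier L \<and> y \<in> carrier L}"

text \<open>
  The bracket is the bilinear extension of the prescription on pure tensors, obtained by lifting
  in each argument.
\<close>

definition current_lie_algebra ::
    "('k, 'r) ring_scheme \<Rightarrow> ('k, 'g, 'l) lie_algebra_scheme \<Rightarrow> ('k, 's, 'n) module_scheme
      \<Rightarrow> ('k, ('g \<times> 's \<Rightarrow> 'k) set) lie_algebra"
  where "current_lie_algebra K L S =
    (let T = tensor_product K L S in
      module.extend T (lie_algebra.fields (\<lambda>u v.
        tensor_lift K T (\<lambda>x s.
          tensor_lift K T (\<lambda>y t. pure_tensor K L S (bracket L x y) (s \<otimes>\<^bsub>S\<^esub> t)) v) u)))"

text \<open>
  Linear endomaps are taken to be \<open>extensional\<close>, so that elements of the centroid are equal iff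
  they agree on the carrier of the Lie algebra.
\<close>

definition centroid ::
    "('k, 'r) ring_scheme \<Rightarrow> ('k, 'g, 'l) lie_algebra_scheme \<Rightarrow> ('k, 'g \<Rightarrow> 'g) module"
  where "centroid K L =
    \<lparr>carrier = {T. T \<in> extensional (carrier L) \<and> linear_map K L L T \<and>
       (\<forall>x\<in>carrier L. \<forall>y\<in>carrier L. T (bracket L x y) = bracket L (T x) y)},
     mult = undefined, one = undefined,
     zero = (\<lambda>x\<in>carrier L. \<zero>\<^bsub>L\<^esub>), add = (\<lambda>T T'. \<lambda>x\<in>carrier L. T x \<oplus>\<^bsub>L\<^esub> T' x),
     smult = (\<lambda>a T. \<lambda>x\<in>carrier L. a \<odot>\<^bsub>L\<^esub> T x)\<rparr>"

text \<open>
  If \<open>V\<close> is finite-dimensional and \<open>B\<close> is a non-degenerate bilinear form on it, every linear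
  endomap of \<open>V\<close> has exactly one adjoint.
\<close>

definition form_adjoint ::
    "('k, 'r) ring_scheme \<Rightarrow> ('k, 'v, 'm) module_scheme \<Rightarrow> ('v \<Rightarrow> 'v \<Rightarrow> 'k)
      \<Rightarrow> ('v \<Rightarrow> 'v) \<Rightarrow> 'v \<Rightarrow> 'v"
  where "form_adjoint K V B T =
    (THE T'. T' \<in> extensional (carrier V) \<and> linear_map K V V T' \<and>
      (\<forall>x\<in>carrier V. \<forall>y\<in>carrier V. B (T x) y = B x (T' y)))"

end

theory Submission
  imports Defs
begin

text \<open>
  Forms \<open>C\<close> on the current algebra and families \<open>\<alpha>\<close> of endomaps of the Lie algebra determine each
  other through \<open>C (x \<otimes> t) (y \<otimes> s) = B (\<alpha> s t x) y\<close>: given \<open>C\<close>, the map \<open>\<alpha> s t\<close> exists because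
  \<open>B\<close> is non-degenerate and the Lie algebra is finite-dimensional. Under this correspondence
  symmetry of \<open>C\<close> is the adjoint condition, and
  \<open>C u (y \<otimes> s) = B (\<F>(s) u) y\<close> identifies the radical of \<open>C\<close> with the common kernel of the \<open>\<F>(s)\<close>.
  Since \<open>[x, y] \<otimes> s = [x \<otimes> s, y \<otimes> 1]\<close>, invariance of \<open>C\<close> lets the elements of \<open>S\<close> move between
  the arguments, which gives the centroid property and condition (i); conversely these two reduce both sides of the invariance of \<open>C\<close> on pure tensors
  to \<open>B (\<alpha> (r s t) 1 [x, y]) z\<close>.
\<close>

section \<open>Linear maps, submodules and spans\<close>

text \<open>The tensor product is a concrete quotient of a free module, so a tensor has no canonical
  expression as a sum. Identities on it are therefore phrased as equalities of two linear maps: the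
  set where they agree is a submodule, so checking pure tensors suffices, and several tensor
  arguments are treated one at a time. Bases are avoided as well. Functionals are represented by
  extending a partial solution along a finite spanning set; a generator at which no correction is
  possible is already matched. The order of the indices, with the scalar of the second argument of
  \<open>C\<close> first in \<open>\<alpha> s t\<close>, is dictated by \<open>\<F>(s)\<close>,
  which for fixed \<open>s\<close> consumes a tensor standing in the first argument. The maps
  \<open>\<alpha> s t\<close> are obtained for each pair separately; uniqueness of representing
  vectors is what makes the family bilinear.\<close>

lemma linear_mapI:
  assumes "\<And>x. x \<in> carrier V \<Longrightarrow> h x \<in> carrier W"
    and "\<And>x y. \<lbrakk>x \<in> carrier V; y \<in> carrier V\<rbrakk> \<Longrightarrow> h (x \<oplus>\<^bsub>V\<^esub> y) = h x \<oplus>\<^bsub>W\<^esub> h y"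
    and "\<And>a x. \<lbrakk>a \<in> carrier K; x \<in> carrier V\<rbrakk> \<Longrightarrow> h (a \<odot>\<^bsub>V\<^esub> x) = a \<odot>\<^bsub>W\<^esub> h x"
  shows "linear_map K V W h"
  using assms by (auto simp: linear_map_def)

lemma linear_map_closed: "\<lbrakk>linear_map K V W h; x \<in> carrier V\<rbrakk> \<Longrightarrow> h x \<in> carrier W"
  by (auto simp: linear_map_def)

lemma linear_map_add:
  "\<lbrakk>linear_map K V W h; x \<in> carrier V; y \<in> carrier V\<rbrakk> \<Longrightarrow> h (x \<oplus>\<^bsub>V\<^esub> y) = h x \<oplus>\<^bsub>W\<^esub> h y"
  by (auto simp: linear_map_def)

lemma linear_map_smult:
  "\<lbrakk>linear_map K V W h; a \<in> carrier K; x \<in> carrier V\<rbrakk> \<Longrightarrow> h (a \<odot>\<^bsub>V\<^esub> x) = a \<odot>\<^bsub>W\<^esub> h x"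
  by (auto simp: linear_map_def)

lemma linear_map_comp:
  assumes "linear_map K V W g" "linear_map K U V h"
  shows "linear_map K U W (\<lambda>x. g (h x))"
  using assms by (auto simp: linear_map_def Pi_iff)

lemma bilinear_map_left: "\<lbrakk>bilinear_map K U V W f; y \<in> carrier V\<rbrakk> \<Longrightarrow> linear_map K U W (\<lambda>x. f x y)"
  by (auto simp: bilinear_map_def)

lemma bilinear_map_right: "\<lbrakk>bilinear_map K U V W f; x \<in> carrier U\<rbrakk> \<Longrightarrow> linear_map K V W (f x)"
  by (auto simp: bilinear_map_def)

lemma bilinear_map_closed:
  "\<lbrakk>bilinear_map K U V W f; x \<in> carrier U; y \<in> carrier V\<rbrakk> \<Longrightarrow> f x y \<in> carrier W"
  by (auto simp: bilinear_map_def linear_map_def)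

lemma (in module) smult_minus_one: "x \<in> carrier M \<Longrightarrow> (\<ominus> \<one>) \<odot>\<^bsub>M\<^esub> x = \<ominus>\<^bsub>M\<^esub> x"
  by (simp add: smult_l_minus)

lemma linear_map_zero:
  assumes "module K V" "module K W" "linear_map K V W h"
  shows "h \<zero>\<^bsub>V\<^esub> = \<zero>\<^bsub>W\<^esub>"
proof -
  interpret V: module K V by fact
  interpret W: module K W by fact
  have "h (\<zero>\<^bsub>K\<^esub> \<odot>\<^bsub>V\<^esub> \<zero>\<^bsub>V\<^esub>) = \<zero>\<^bsub>K\<^esub> \<odot>\<^bsub>W\<^esub> h \<zero>\<^bsub>V\<^esub>"
    using assms(3) by (intro linear_map_smult) auto
  then show ?thesis
    using linear_map_closed[OF assms(3), of "\<zero>\<^bsub>V\<^esub>"] by simp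
qed

lemma linear_map_minus:
  assumes "module K V" "module K W" "linear_map K V W h" "x \<in> carrier V" "y \<in> carrier V"
  shows "h (x \<ominus>\<^bsub>V\<^esub> y) = h x \<ominus>\<^bsub>W\<^esub> h y"
proof -
  interpret V: module K V by fact
  interpret W: module K W by fact
  have "h (\<ominus>\<^bsub>V\<^esub> y) = h ((\<ominus>\<^bsub>K\<^esub> \<one>\<^bsub>K\<^esub>) \<odot>\<^bsub>V\<^esub> y)"
    using assms by (simp add: V.smult_minus_one)
  also have "\<dots> = \<ominus>\<^bsub>W\<^esub> h y"
    using assms linear_map_closed[OF assms(3)]
    by (simp add: linear_map_smult[OF assms(3)] W.smult_minus_one)
  finally show ?thesis
    using assms linear_map_add[OF assms(3), of x "\<ominus>\<^bsub>V\<^esub> y"] by (simp add: a_minus_def)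
qed

lemma (in abelian_group) minus_eq_zero_iff:
  "\<lbrakk>x \<in> carrier G; y \<in> carrier G\<rbrakk> \<Longrightarrow> x \<ominus> y = \<zero> \<longleftrightarrow> x = y"
  by (metis a_minus_def add.inv_closed add.inv_equality add.inv_inv add.r_inv)

lemma (in module) submoduleI_smult:
  assumes "H \<subseteq> carrier M" "\<zero>\<^bsub>M\<^esub> \<in> H"
    and "\<And>x y. \<lbrakk>x \<in> H; y \<in> H\<rbrakk> \<Longrightarrow> x \<oplus>\<^bsub>M\<^esub> y \<in> H"
    and "\<And>a x. \<lbrakk>a \<in> carrier R; x \<in> H\<rbrakk> \<Longrightarrow> a \<odot>\<^bsub>M\<^esub> x \<in> H"
  shows "submodule H R M"
proof (rule submoduleI)
  show "\<ominus>\<^bsub>M\<^esub> x \<in> H" if "x \<in> H" for x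
    using assms(1) assms(4)[of "\<ominus> \<one>" x] that by (auto simp: smult_minus_one)
qed (use assms in auto)

text \<open>Turns an equality of linear maps into membership in a submodule, so that it only has to
  be checked on generators: on pure tensors, on brackets inside the derived algebra, or on a
  spanning set.\<close>

lemma submodule_equalizer:
  assumes "module K V" "module K W" "linear_map K V W h" "linear_map K V W h'"
  shows "submodule {x \<in> carrier V. h x = h' x} K V"
proof -
  interpret V: module K V by fact
  show ?thesis
    using assms
    by (intro V.submoduleI_smult) (auto simp: linear_map_zero linear_map_add linear_map_smult)
qed

lemma submodule_zero_mem: "submodule H K V \<Longrightarrow> \<zero>\<^bsub>V\<^esub> \<in> H"
  by (drule submodule.axioms(1), drule subgroup.one_closed) simp

lemma submodule_kernel:
  assumes "module K V" "module K W" "linear_map K V W h"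
  shows "submodule {x \<in> carrier V. h x = \<zero>\<^bsub>W\<^esub>} K V"
proof -
  interpret V: module K V by fact
  interpret W: module K W by fact
  show ?thesis
    using assms
    by (intro V.submoduleI_smult) (auto simp: linear_map_zero linear_map_add linear_map_smult)
qed

lemma module_span_minimal: "\<lbrakk>submodule H K V; A \<subseteq> H\<rbrakk> \<Longrightarrow> module_span K V A \<subseteq> H"
  by (auto simp: module_span_def)

lemma module_span_superset: "A \<subseteq> module_span K V A"
  by (auto simp: module_span_def)

lemma (in module) submodule_module_span:
  assumes "A \<subseteq> carrier M"
  shows "submodule (module_span R M A) R M"
proof (rule submoduleI_smult)
  show "module_span R M A \<subseteq> carrier M"
    by (rule module_span_minimal[OF carrier_is_submodule assms])
qed (auto simp: module_span_def submodule_zero_mem submoduleE)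

lemma self_module_simps [simp]:
  "carrier (self_module K) = carrier K" "zero (self_module K) = zero K"
  "add (self_module K) = add K" "smult (self_module K) = mult K"
  by (simp_all add: self_module_def)

lemma (in cring) module_self_module: "module R (self_module R)"
proof (rule moduleI)
  show "abelian_group (self_module R)"
    using l_neg by (intro abelian_groupI) (auto simp: self_module_def a_ac intro!: bexI[of _ "\<ominus> x" for x])
qed (auto simp: self_module_def is_cring l_distr r_distr m_assoc)

text \<open>Together with \<open>linear_map_scale\<close> this makes the right-hand sides of
  linearity laws linear maps themselves, so that both sides of such a law can be compared on pure
  tensors.\<close>

lemma linear_map_plus:
  assumes "module K W" "linear_map K V W g" "linear_map K V W h"
  shows "linear_map K V W (\<lambda>x. g x \<oplus>\<^bsub>W\<^esub> h x)"
proof -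
  interpret W: module K W by fact
  note gh = assms(2,3)
  show ?thesis
    using gh[THEN linear_map_closed] gh[THEN linear_map_add] gh[THEN linear_map_smult]
    by (intro linear_mapI) (auto simp: W.smult_r_distr W.a_ac)
qed

lemma linear_map_scale:
  assumes "module K W" "linear_map K V W h" "a \<in> carrier K"
  shows "linear_map K V W (\<lambda>x. a \<odot>\<^bsub>W\<^esub> h x)"
proof -
  interpret W: module K W by fact
  show ?thesis
  proof (rule linear_mapI)
    fix b x assume bx: "b \<in> carrier K" "x \<in> carrier V"
    then have "a \<odot>\<^bsub>W\<^esub> h (b \<odot>\<^bsub>V\<^esub> x) = (a \<otimes>\<^bsub>K\<^esub> b) \<odot>\<^bsub>W\<^esub> h x"
      using assms linear_map_closed[OF assms(2)] linear_map_smult[OF assms(2)]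
      by (simp add: W.smult_assoc1)
    also have "\<dots> = b \<odot>\<^bsub>W\<^esub> (a \<odot>\<^bsub>W\<^esub> h x)"
      using bx assms linear_map_closed[OF assms(2)]
      by (simp add: W.R.m_comm[of a b] W.smult_assoc1)
    finally show "a \<odot>\<^bsub>W\<^esub> h (b \<odot>\<^bsub>V\<^esub> x) = b \<odot>\<^bsub>W\<^esub> (a \<odot>\<^bsub>W\<^esub> h x)" .
  qed (use assms linear_map_closed[OF assms(2)] linear_map_add[OF assms(2)] in
    \<open>simp_all add: W.smult_r_distr\<close>)
qed

lemma submodule_preimage:
  assumes "module K V" "module K W" "linear_map K V W h" "submodule H K W"
  shows "submodule {x \<in> carrier V. h x \<in> H} K V"
proof -
  interpret V: module K V by fact
  interpret W: module K W by fact
  show ?thesis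
    using assms(3) W.submoduleE(4,5)[OF assms(4)] submodule_zero_mem[OF assms(4)]
    by (intro V.submoduleI_smult)
       (simp_all add: subset_iff linear_map_zero[OF assms(1-3)] linear_map_add linear_map_smult)
qed


section \<open>Free modules\<close>

lemma free_module_simps:
  "zero (free_module K A) = (\<lambda>p. \<zero>\<^bsub>K\<^esub>)"
  "add (free_module K A) = (\<lambda>f g p. f p \<oplus>\<^bsub>K\<^esub> g p)"
  "smult (free_module K A) = (\<lambda>a f p. a \<otimes>\<^bsub>K\<^esub> f p)"
  by (simp_all add: free_module_def)

lemma free_module_carrier:
  "f \<in> carrier (free_module K A) \<longleftrightarrow>
    (\<forall>p. f p \<in> carrier K) \<and> finite {p. f p \<noteq> \<zero>\<^bsub>K\<^esub>} \<and> {p. f p \<noteq> \<zero>\<^bsub>K\<^esub>} \<subseteq> A"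
  by (auto simp: free_module_def)

lemma (in cring) module_free_module: "module R (free_module R A)"
proof -
  let ?F = "free_module R A"
  have add: "(\<lambda>p. f p \<oplus> g p) \<in> carrier ?F" if "f \<in> carrier ?F" "g \<in> carrier ?F" for f g
  proof -
    have sub: "{p. f p \<oplus> g p \<noteq> \<zero>} \<subseteq> {p. f p \<noteq> \<zero>} \<union> {p. g p \<noteq> \<zero>}" by auto
    moreover have "finite ({p. f p \<noteq> \<zero>} \<union> {p. g p \<noteq> \<zero>})"
      using that by (auto simp: free_module_carrier)
    ultimately have "finite {p. f p \<oplus> g p \<noteq> \<zero>}" by (rule finite_subset)
    moreover have "{p. f p \<oplus> g p \<noteq> \<zero>} \<subseteq> A"
      using sub that unfolding free_module_carrier by blast
    ultimately show ?thesis using that unfolding free_module_carrier by blast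
  qed
  have smult: "(\<lambda>p. a \<otimes> f p) \<in> carrier ?F" if "a \<in> carrier R" "f \<in> carrier ?F" for a f
  proof -
    have sub: "{p. a \<otimes> f p \<noteq> \<zero>} \<subseteq> {p. f p \<noteq> \<zero>}" using that by auto
    moreover have "finite {p. f p \<noteq> \<zero>}" using that by (auto simp: free_module_carrier)
    ultimately have "finite {p. a \<otimes> f p \<noteq> \<zero>}" by (rule finite_subset)
    moreover have "{p. a \<otimes> f p \<noteq> \<zero>} \<subseteq> A"
      using sub that unfolding free_module_carrier by blast
    ultimately show ?thesis using that unfolding free_module_carrier by blast
  qed
  have mem: "f p \<in> carrier R" if "f \<in> carrier ?F" for f p
    using that by (simp add: free_module_carrier)
  show ?thesis
  proof (rule moduleI)
    show "abelian_group ?F"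
    proof (rule abelian_groupI)
      fix f assume f: "f \<in> carrier ?F"
      show "\<exists>g \<in> carrier ?F. g \<oplus>\<^bsub>?F\<^esub> f = \<zero>\<^bsub>?F\<^esub>"
      proof
        \<comment> \<open>The inverse is written as a multiple of \<open>f\<close> so that
          \<open>smult\<close> already provides its finite support.\<close>
        show "(\<lambda>p. \<ominus> \<one> \<otimes> f p) \<in> carrier ?F" by (rule smult) (use f in auto)
        show "(\<lambda>p. \<ominus> \<one> \<otimes> f p) \<oplus>\<^bsub>?F\<^esub> f = \<zero>\<^bsub>?F\<^esub>"
          using f by (simp add: free_module_simps mem l_minus l_neg)
      qed
      show "\<zero>\<^bsub>?F\<^esub> \<oplus>\<^bsub>?F\<^esub> f = f" using f by (simp add: free_module_simps mem)
    next
      fix f g h assume "f \<in> carrier ?F" "g \<in> carrier ?F" "h \<in> carrier ?F"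
      then show "f \<oplus>\<^bsub>?F\<^esub> g \<oplus>\<^bsub>?F\<^esub> h = f \<oplus>\<^bsub>?F\<^esub> (g \<oplus>\<^bsub>?F\<^esub> h)"
        by (simp add: free_module_simps mem a_assoc)
    next
      fix f g assume "f \<in> carrier ?F" "g \<in> carrier ?F"
      then show "f \<oplus>\<^bsub>?F\<^esub> g = g \<oplus>\<^bsub>?F\<^esub> f" "f \<oplus>\<^bsub>?F\<^esub> g \<in> carrier ?F"
        by (simp_all add: free_module_simps mem a_comm add)
    next
      show "\<zero>\<^bsub>?F\<^esub> \<in> carrier ?F" by (simp add: free_module_simps(1)) (simp add: free_module_carrier)
    qed
  qed (simp_all add: free_module_simps smult is_cring mem l_distr r_distr m_assoc)
qed

lemma (in cring) free_gen_closed: "p \<in> A \<Longrightarrow> free_gen R p \<in> carrier (free_module R A)"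
  by (auto simp: free_module_carrier free_gen_def)

lemma (in cring) free_module_generated:
  assumes H: "submodule H R (free_module R A)" and gen: "\<And>p. p \<in> A \<Longrightarrow> free_gen R p \<in> H"
  shows "carrier (free_module R A) \<subseteq> H"
proof
  interpret F: module R "free_module R A" by (rule module_free_module)
  \<comment> \<open>The induction runs over a finite set containing the support rather than over the
    support itself: erasing the coordinate at \<open>p\<close> then shrinks the bounding set even
    when \<open>c p\<close> is zero.\<close>
  have support: "c \<in> H" if "finite P" "c \<in> carrier (free_module R A)" "{p. c p \<noteq> \<zero>} \<subseteq> P" for c P
    using that
  proof (induction P arbitrary: c rule: finite_induct)
    case empty
    then have "c = \<zero>\<^bsub>free_module R A\<^esub>" by (auto simp: free_module_simps)
    then show ?case using submodule_zero_mem[OF H] by simp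
  next
    case (insert p P)
    have d: "c(p := \<zero>) \<in> H"
    proof (rule insert.IH)
      have "{q. (c(p := \<zero>)) q \<noteq> \<zero>} \<subseteq> {q. c q \<noteq> \<zero>}" by auto
      moreover have "finite {q. c q \<noteq> \<zero>}" using insert.prems(1) by (simp add: free_module_carrier)
      ultimately have "finite {q. (c(p := \<zero>)) q \<noteq> \<zero>}" by (rule finite_subset)
      then show "c(p := \<zero>) \<in> carrier (free_module R A)"
        using insert.prems(1) unfolding free_module_carrier by simp blast
      show "{q. (c(p := \<zero>)) q \<noteq> \<zero>} \<subseteq> P" using insert.prems(2) by auto
    qed
    show ?case
    proof (cases "c p = \<zero>")
      case True
      then show ?thesis using d by (simp add: fun_upd_idem)
    next
      case False
      have mem: "c q \<in> carrier R" for q using insert.prems(1) by (simp add: free_module_carrier)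
      then have cp: "c p \<in> carrier R" .
      have "p \<in> A" using False insert.prems(1) unfolding free_module_carrier by blast
      then have "c p \<odot>\<^bsub>free_module R A\<^esub> free_gen R p \<oplus>\<^bsub>free_module R A\<^esub> c(p := \<zero>) \<in> H"
        by (intro F.submoduleE(4,5)[OF H] gen d cp)
      also have "c p \<odot>\<^bsub>free_module R A\<^esub> free_gen R p \<oplus>\<^bsub>free_module R A\<^esub> c(p := \<zero>) = c"
        using mem cp by (auto simp: free_module_simps free_gen_def)
      finally show ?thesis .
    qed
  qed
  fix c assume c: "c \<in> carrier (free_module R A)"
  then have "finite {p. c p \<noteq> \<zero>}" by (simp add: free_module_carrier)
  then show "c \<in> H" using support[OF _ c subset_refl] by simp
qed

text \<open>This is the sum inside \<open>tensor_lift\<close>, isolated for an arbitrary index set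
  so that its linearity is a statement about free modules alone.\<close>

definition linear_extension ::
    "('k, 'r) ring_scheme \<Rightarrow> ('k, 'u, 'l) module_scheme \<Rightarrow> ('a \<Rightarrow> 'u) \<Rightarrow> ('a \<Rightarrow> 'k) \<Rightarrow> 'u"
  where "linear_extension K U f c = (\<Oplus>\<^bsub>U\<^esub>p\<in>{p. c p \<noteq> \<zero>\<^bsub>K\<^esub>}. c p \<odot>\<^bsub>U\<^esub> f p)"

text \<open>Supports shrink unpredictably under addition because of cancellation. Enlarging the
  index set adds only zero terms, so the extensions of \<open>c\<close>, \<open>d\<close> and their
  sum can all be taken over one common finite set.\<close>

lemma (in module) linear_extension_superset:
  assumes "c \<in> carrier (free_module R A)" "f \<in> A \<rightarrow> carrier M"
    and "finite P" "{p. c p \<noteq> \<zero>} \<subseteq> P" "P \<subseteq> A"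
  shows "linear_extension R M f c = (\<Oplus>\<^bsub>M\<^esub>p\<in>P. c p \<odot>\<^bsub>M\<^esub> f p)"
  unfolding linear_extension_def
  using assms
  by (intro M.add.finprod_mono_neutral_cong_left) (auto simp: free_module_carrier Pi_iff subset_iff)

lemma (in module) linear_map_linear_extension:
  assumes f: "f \<in> A \<rightarrow> carrier M"
  shows "linear_map R (free_module R A) M (linear_extension R M f)"
proof (rule linear_mapI)
  interpret F: module R "free_module R A" by (rule module_free_module)
  let ?F = "free_module R A"
  have fin: "finite {p. c p \<noteq> \<zero>}" "{p. c p \<noteq> \<zero>} \<subseteq> A" "\<And>p. c p \<in> carrier R"
    if "c \<in> carrier ?F" for c
    using that by (auto simp: free_module_carrier)
  have [simp]: "f p \<in> carrier M" if "p \<in> A" for p using f that by auto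
  fix c assume c: "c \<in> carrier ?F"
  show "linear_extension R M f c \<in> carrier M"
    unfolding linear_extension_def using fin[OF c] by (intro M.finsum_closed) auto
  {
    fix d assume d: "d \<in> carrier ?F"
    let ?P = "{p. c p \<noteq> \<zero>} \<union> {p. d p \<noteq> \<zero>}"
    have cd: "c \<oplus>\<^bsub>?F\<^esub> d \<in> carrier ?F" using c d by (rule F.add.m_closed)
    have P: "finite ?P" "?P \<subseteq> A" using fin[OF c] fin[OF d] by auto
    have [simp]: "f p \<in> carrier M" if "p \<in> ?P" for p using P that by auto
    have "linear_extension R M f (c \<oplus>\<^bsub>?F\<^esub> d) = (\<Oplus>\<^bsub>M\<^esub>p\<in>?P. (c \<oplus>\<^bsub>?F\<^esub> d) p \<odot>\<^bsub>M\<^esub> f p)"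
      using P f cd by (intro linear_extension_superset) (auto simp: free_module_simps(2))
    also have "\<dots> = (\<Oplus>\<^bsub>M\<^esub>p\<in>?P. c p \<odot>\<^bsub>M\<^esub> f p \<oplus>\<^bsub>M\<^esub> d p \<odot>\<^bsub>M\<^esub> f p)"
      using fin[OF c] fin[OF d] P
      by (intro M.finsum_cong') (auto simp: free_module_simps(2) smult_l_distr subset_iff)
    also have "\<dots> = (\<Oplus>\<^bsub>M\<^esub>p\<in>?P. c p \<odot>\<^bsub>M\<^esub> f p) \<oplus>\<^bsub>M\<^esub> (\<Oplus>\<^bsub>M\<^esub>p\<in>?P. d p \<odot>\<^bsub>M\<^esub> f p)"
      using fin[OF c] fin[OF d] P by (intro M.finsum_addf) auto
    also have "\<dots> = linear_extension R M f c \<oplus>\<^bsub>M\<^esub> linear_extension R M f d"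
      using P c d f by (subst (1 2) linear_extension_superset[where P = ?P]) auto
    finally show "linear_extension R M f (c \<oplus>\<^bsub>?F\<^esub> d)
        = linear_extension R M f c \<oplus>\<^bsub>M\<^esub> linear_extension R M f d" .
  }
  {
    fix a assume a: "a \<in> carrier R"
    let ?P = "{p. c p \<noteq> \<zero>}"
    have ac: "a \<odot>\<^bsub>?F\<^esub> c \<in> carrier ?F" using a c by (rule F.smult_closed)
    have "linear_extension R M f (a \<odot>\<^bsub>?F\<^esub> c) = (\<Oplus>\<^bsub>M\<^esub>p\<in>?P. (a \<odot>\<^bsub>?F\<^esub> c) p \<odot>\<^bsub>M\<^esub> f p)"
      using fin[OF c] f a ac by (intro linear_extension_superset) (auto simp: free_module_simps(3))
    also have "\<dots> = (\<Oplus>\<^bsub>M\<^esub>p\<in>?P. a \<odot>\<^bsub>M\<^esub> (c p \<odot>\<^bsub>M\<^esub> f p))"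
      using fin[OF c] a
      by (intro M.finsum_cong') (auto simp: free_module_simps(3) smult_assoc1 subset_iff)
    also have "\<dots> = a \<odot>\<^bsub>M\<^esub> linear_extension R M f c"
      unfolding linear_extension_def
      using fin[OF c] a by (intro finsum_smult_ldistr[symmetric]) auto
    finally show "linear_extension R M f (a \<odot>\<^bsub>?F\<^esub> c) = a \<odot>\<^bsub>M\<^esub> linear_extension R M f c" .
  }
qed

lemma (in module) linear_extension_free_gen:
  assumes "f \<in> A \<rightarrow> carrier M" "p \<in> A"
  shows "linear_extension R M f (free_gen R p) = f p"
proof -
  have fp: "f p \<in> carrier M" using assms by auto
  have "linear_extension R M f (free_gen R p) = (\<Oplus>\<^bsub>M\<^esub>q\<in>{p}. free_gen R p q \<odot>\<^bsub>M\<^esub> f q)"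
    using assms by (intro linear_extension_superset free_gen_closed) (auto simp: free_gen_def)
  also have "\<dots> = free_gen R p p \<odot>\<^bsub>M\<^esub> f p"
    using fp by (subst M.finsum_insert) (auto simp: free_gen_def)
  finally show ?thesis
    using fp by (simp add: free_gen_def)
qed


section \<open>Quotient modules\<close>

lemma quotient_module_simps:
  "carrier (quotient_module V N) = a_rcosets\<^bsub>V\<^esub> N"
  "zero (quotient_module V N) = N"
  "add (quotient_module V N) = set_add V"
  "smult (quotient_module V N) = (\<lambda>a C. \<Union>v\<in>C. N +>\<^bsub>V\<^esub> (a \<odot>\<^bsub>V\<^esub> v))"
  by (simp_all add: quotient_module_def)

context module
begin

lemma abelian_subgroup_submodule: "submodule N R M \<Longrightarrow> abelian_subgroup N M"
  by (intro abelian_subgroupI3 additive_subgroupI submodule.axioms(1) M.abelian_group_axioms)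

lemma quotient_module_carrier:
  "carrier (quotient_module M N) = (\<lambda>v. N +>\<^bsub>M\<^esub> v) ` carrier M"
  by (auto simp: quotient_module_simps A_RCOSETS_def')

lemma quotient_coset_add:
  assumes "submodule N R M" "v \<in> carrier M" "w \<in> carrier M"
  shows "(N +>\<^bsub>M\<^esub> v) \<oplus>\<^bsub>quotient_module M N\<^esub> (N +>\<^bsub>M\<^esub> w) = N +>\<^bsub>M\<^esub> (v \<oplus>\<^bsub>M\<^esub> w)"
  using abelian_subgroup.a_rcos_sum[OF abelian_subgroup_submodule] assms
  by (simp add: quotient_module_simps)

lemma quotient_coset_eqI:
  assumes "submodule N R M" "v \<in> carrier M" "w \<in> carrier M" "v \<ominus>\<^bsub>M\<^esub> w \<in> N"
  shows "N +>\<^bsub>M\<^esub> v = N +>\<^bsub>M\<^esub> w"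
proof -
  interpret N: abelian_subgroup N M by (rule abelian_subgroup_submodule) fact
  have "v = (v \<ominus>\<^bsub>M\<^esub> w) \<oplus>\<^bsub>M\<^esub> w"
    using assms by (simp add: a_minus_def M.a_assoc M.l_neg)
  then have "v \<in> N +>\<^bsub>M\<^esub> w"
    using assms(4) by (auto simp: a_r_coset_def')
  from N.a_repr_independence'[OF this assms(3)] show ?thesis ..
qed

text \<open>The union in the definition of the scalar multiple runs over all representatives. Since
  \<open>N\<close> is closed under scalars, each of them contributes the same coset, and the union
  collapses because a coset is non-empty.\<close>

lemma quotient_coset_smult:
  assumes N: "submodule N R M" and "a \<in> carrier R" "v \<in> carrier M"
  shows "a \<odot>\<^bsub>quotient_module M N\<^esub> (N +>\<^bsub>M\<^esub> v) = N +>\<^bsub>M\<^esub> (a \<odot>\<^bsub>M\<^esub> v)"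
proof -
  interpret N: abelian_subgroup N M by (rule abelian_subgroup_submodule) fact
  have "N +>\<^bsub>M\<^esub> (a \<odot>\<^bsub>M\<^esub> w) = N +>\<^bsub>M\<^esub> (a \<odot>\<^bsub>M\<^esub> v)" if w: "w \<in> N +>\<^bsub>M\<^esub> v" for w
  proof -
    obtain n where n: "n \<in> N" "w = n \<oplus>\<^bsub>M\<^esub> v" using w by (auto simp: a_r_coset_def')
    have nM: "n \<in> carrier M" using n N.a_subset by auto
    have "a \<odot>\<^bsub>M\<^esub> n \<in> N" using N n assms by (simp add: submodule.smult_closed)
    then have "a \<odot>\<^bsub>M\<^esub> w \<in> N +>\<^bsub>M\<^esub> (a \<odot>\<^bsub>M\<^esub> v)"
      using n nM assms by (auto simp: a_r_coset_def' smult_r_distr)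
    from N.a_repr_independence'[OF this] show ?thesis
      using assms by simp
  qed
  moreover have "N +>\<^bsub>M\<^esub> v \<noteq> {}" using N.a_rcos_self[OF assms(3)] by auto
  ultimately show ?thesis by (simp add: quotient_module_simps)
qed

lemma module_quotient_module:
  assumes N: "submodule N R M"
  shows "module R (quotient_module M N)"
proof (rule moduleI)
  interpret N: abelian_subgroup N M by (rule abelian_subgroup_submodule) fact
  \<comment> \<open>Rewriting the zero as the coset of zero puts all operations in coset form, so
    that the module laws are inherited from \<open>M\<close>.\<close>
  have zero: "\<zero>\<^bsub>quotient_module M N\<^esub> = N +>\<^bsub>M\<^esub> \<zero>\<^bsub>M\<^esub>"
    using N.a_subset by (simp add: quotient_module_simps)
  note simps = zero quotient_module_carrier quotient_coset_add[OF N] quotient_coset_smult[OF N]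
  show "abelian_group (quotient_module M N)"
  proof (rule abelian_groupI)
    fix x assume "x \<in> carrier (quotient_module M N)"
    then obtain v where v: "v \<in> carrier M" "x = N +>\<^bsub>M\<^esub> v" by (auto simp: simps)
    then have "(N +>\<^bsub>M\<^esub> \<ominus>\<^bsub>M\<^esub> v) \<oplus>\<^bsub>quotient_module M N\<^esub> x = \<zero>\<^bsub>quotient_module M N\<^esub>"
      by (simp add: simps M.l_neg)
    then show "\<exists>y\<in>carrier (quotient_module M N).
        y \<oplus>\<^bsub>quotient_module M N\<^esub> x = \<zero>\<^bsub>quotient_module M N\<^esub>"
      using v by (auto simp: simps)
  next
    fix x y assume "x \<in> carrier (quotient_module M N)" "y \<in> carrier (quotient_module M N)"
    then show "x \<oplus>\<^bsub>quotient_module M N\<^esub> y = y \<oplus>\<^bsub>quotient_module M N\<^esub> x"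
      by (auto simp: simps M.a_comm)
  qed (auto simp: simps M.a_assoc)
  show "cring R" by (rule is_cring)
  show "(a \<oplus> b) \<odot>\<^bsub>quotient_module M N\<^esub> x =
      a \<odot>\<^bsub>quotient_module M N\<^esub> x \<oplus>\<^bsub>quotient_module M N\<^esub> b \<odot>\<^bsub>quotient_module M N\<^esub> x"
    if "a \<in> carrier R" "b \<in> carrier R" "x \<in> carrier (quotient_module M N)" for a b x
    using that by (auto simp: simps smult_l_distr)
  show "a \<odot>\<^bsub>quotient_module M N\<^esub> (x \<oplus>\<^bsub>quotient_module M N\<^esub> y) =
      a \<odot>\<^bsub>quotient_module M N\<^esub> x \<oplus>\<^bsub>quotient_module M N\<^esub> a \<odot>\<^bsub>quotient_module M N\<^esub> y"
    if "a \<in> carrier R" "x \<in> carrier (quotient_module M N)" "y \<in> carrier (quotient_module M N)"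
    for a x y
    using that by (auto simp: simps smult_r_distr)
qed (auto simp: quotient_module_carrier quotient_coset_smult[OF N] smult_assoc1)

lemma linear_map_quotient_proj:
  "submodule N R M \<Longrightarrow> linear_map R M (quotient_module M N) (\<lambda>v. N +>\<^bsub>M\<^esub> v)"
  by (intro linear_mapI) (auto simp: quotient_coset_add quotient_coset_smult quotient_module_carrier)

end


section \<open>Tensor products\<close>

context
  fixes K :: "('k, 'r) ring_scheme"
    and V :: "('k, 'v, 'm) module_scheme"
    and W :: "('k, 'w, 'n) module_scheme"
  assumes V: "module K V" and W: "module K W"
begin

interpretation V: module K V by (rule V)
interpretation W: module K W by (rule W)
interpretation F: module K "free_module K (carrier V \<times> carrier W)"
  by (rule V.module_free_module)

abbreviation (input) free where "free \<equiv> free_module K (carrier V \<times> carrier W)"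
abbreviation (input) ker where "ker \<equiv> tensor_kernel K V W"
abbreviation (input) tensor where "tensor \<equiv> tensor_product K V W"

lemma free_gen_pair_closed:
  "\<lbrakk>x \<in> carrier V; y \<in> carrier W\<rbrakk> \<Longrightarrow> free_gen K (x, y) \<in> carrier free"
  by (simp add: V.free_gen_closed)

lemma tensor_relations_subset: "tensor_relations K V W \<subseteq> carrier free"
  unfolding tensor_relations_def Let_def
  by (auto simp: free_gen_pair_closed)

lemma submodule_tensor_kernel: "submodule ker K free"
  unfolding tensor_kernel_def by (rule F.submodule_module_span[OF tensor_relations_subset])

lemma module_tensor_product: "module K tensor"
  unfolding tensor_product_def by (rule F.module_quotient_module[OF submodule_tensor_kernel])

lemma linear_map_tensor_proj: "linear_map K free tensor (\<lambda>c. ker +>\<^bsub>free\<^esub> c)"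
  unfolding tensor_product_def by (rule F.linear_map_quotient_proj[OF submodule_tensor_kernel])

lemma tensor_carrierE:
  assumes "u \<in> carrier tensor"
  obtains c where "c \<in> carrier free" "u = ker +>\<^bsub>free\<^esub> c"
  using assms by (auto simp: tensor_product_def F.quotient_module_carrier)

lemma tensor_proj_relation:
  assumes "c \<ominus>\<^bsub>free\<^esub> d \<in> tensor_relations K V W" "c \<in> carrier free" "d \<in> carrier free"
  shows "ker +>\<^bsub>free\<^esub> c = ker +>\<^bsub>free\<^esub> d"
  using assms module_span_superset[THEN subsetD] submodule_tensor_kernel
  unfolding tensor_kernel_def by (intro F.quotient_coset_eqI)

text \<open>Each of the four laws corresponds to one of the four families in
  \<open>tensor_relations\<close>, which the quotient sends to zero.\<close>

lemma bilinear_map_pure_tensor: "bilinear_map K V W tensor (pure_tensor K V W)"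
proof -
  note add = linear_map_add[OF linear_map_tensor_proj]
    and smult = linear_map_smult[OF linear_map_tensor_proj]
  have "pure_tensor K V W (x \<oplus>\<^bsub>V\<^esub> x') y
      = pure_tensor K V W x y \<oplus>\<^bsub>tensor\<^esub> pure_tensor K V W x' y"
    if "x \<in> carrier V" "x' \<in> carrier V" "y \<in> carrier W" for x x' y
    unfolding pure_tensor_def using that
    by (subst add[symmetric]; (intro tensor_proj_relation)?)
       (auto intro!: free_gen_pair_closed simp: tensor_relations_def Let_def)
  moreover have "pure_tensor K V W x (y \<oplus>\<^bsub>W\<^esub> y')
      = pure_tensor K V W x y \<oplus>\<^bsub>tensor\<^esub> pure_tensor K V W x y'"
    if "x \<in> carrier V" "y \<in> carrier W" "y' \<in> carrier W" for x y y'
    unfolding pure_tensor_def using that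
    by (subst add[symmetric]; (intro tensor_proj_relation)?)
       (auto intro!: free_gen_pair_closed simp: tensor_relations_def Let_def)
  moreover have "pure_tensor K V W (a \<odot>\<^bsub>V\<^esub> x) y = a \<odot>\<^bsub>tensor\<^esub> pure_tensor K V W x y"
    "pure_tensor K V W x (a \<odot>\<^bsub>W\<^esub> y) = a \<odot>\<^bsub>tensor\<^esub> pure_tensor K V W x y"
    if "a \<in> carrier K" "x \<in> carrier V" "y \<in> carrier W" for a x y
    unfolding pure_tensor_def using that
    by (subst smult[symmetric]; (intro tensor_proj_relation)?;
        auto intro!: free_gen_pair_closed simp: tensor_relations_def Let_def)+
  moreover have "pure_tensor K V W x y \<in> carrier tensor"
    if "x \<in> carrier V" "y \<in> carrier W" for x y
    unfolding pure_tensor_def using that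
    by (intro linear_map_closed[OF linear_map_tensor_proj] free_gen_pair_closed)
  ultimately show ?thesis
    by (auto simp: bilinear_map_def intro!: linear_mapI)
qed

lemma pure_tensor_closed:
  "\<lbrakk>x \<in> carrier V; y \<in> carrier W\<rbrakk> \<Longrightarrow> pure_tensor K V W x y \<in> carrier tensor"
  by (rule bilinear_map_closed[OF bilinear_map_pure_tensor])

text \<open>The projection from the free module is onto and sends free generators to pure tensors.
  The preimage of the submodule cut out by \<open>P\<close> thus contains all generators, hence
  everything.\<close>

lemma tensor_induct:
  assumes H: "submodule {u \<in> carrier tensor. P u} K tensor"
    and pure: "\<And>x y. \<lbrakk>x \<in> carrier V; y \<in> carrier W\<rbrakk> \<Longrightarrow> P (pure_tensor K V W x y)"
    and u: "u \<in> carrier tensor"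
  shows "P u"
proof -
  let ?G = "{c \<in> carrier free. ker +>\<^bsub>free\<^esub> c \<in> {u \<in> carrier tensor. P u}}"
  have "carrier free \<subseteq> ?G"
  proof (rule V.free_module_generated)
    show "submodule ?G K free"
      by (rule submodule_preimage[OF F.module_axioms module_tensor_product linear_map_tensor_proj H])
    show "free_gen K p \<in> ?G" if "p \<in> carrier V \<times> carrier W" for p
      using that pure pure_tensor_closed
      by (auto simp: free_gen_pair_closed pure_tensor_def)
  qed
  then show ?thesis using u by (auto elim!: tensor_carrierE)
qed

lemma tensor_linear_map_eqI:
  assumes "module K U" "linear_map K tensor U g" "linear_map K tensor U h"
    and "\<And>x y. \<lbrakk>x \<in> carrier V; y \<in> carrier W\<rbrakk> \<Longrightarrow>
      g (pure_tensor K V W x y) = h (pure_tensor K V W x y)"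
    and "u \<in> carrier tensor"
  shows "g u = h u"
  by (rule tensor_induct[where P = "\<lambda>u. g u = h u",
        OF submodule_equalizer[OF module_tensor_product assms(1-3)] assms(4,5)])

context
  fixes U :: "('k, 'u, 'l) module_scheme" and f :: "'v \<Rightarrow> 'w \<Rightarrow> 'u"
  assumes U: "module K U" and f: "bilinear_map K V W U f"
begin

interpretation U: module K U by (rule U)

abbreviation (input) ext where "ext \<equiv> linear_extension K U (\<lambda>p. f (fst p) (snd p))"

lemma linear_map_tensor_ext: "linear_map K free U ext"
  by (rule U.linear_map_linear_extension) (auto intro: bilinear_map_closed[OF f])

lemma tensor_ext_gen:
  "\<lbrakk>x \<in> carrier V; y \<in> carrier W\<rbrakk> \<Longrightarrow> ext (free_gen K (x, y)) = f x y"
  by (subst U.linear_extension_free_gen[where A = "carrier V \<times> carrier W"])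
     (auto intro: bilinear_map_closed[OF f])

text \<open>This is the well-definedness of the lift: bilinearity of \<open>f\<close> says that the
  extension kills every relation, and its kernel, being a submodule, then contains their
  span.\<close>

lemma tensor_kernel_ext:
  assumes "c \<in> ker"
  shows "c \<in> carrier free" "ext c = \<zero>\<^bsub>U\<^esub>"
proof -
  note minus = linear_map_minus[OF F.module_axioms U linear_map_tensor_ext]
    and add = linear_map_add[OF linear_map_tensor_ext]
    and smult = linear_map_smult[OF linear_map_tensor_ext]
    and left = bilinear_map_left[OF f] and right = bilinear_map_right[OF f]
  note simps = free_gen_pair_closed tensor_ext_gen bilinear_map_closed[OF f] U.minus_eq_zero_iff
    minus add smult
  have "tensor_relations K V W \<subseteq> {c \<in> carrier free. ext c = \<zero>\<^bsub>U\<^esub>}"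
    unfolding tensor_relations_def Let_def
    by (auto simp: simps linear_map_add[OF left] linear_map_add[OF right]
        linear_map_smult[OF left] linear_map_smult[OF right])
  then have "ker \<subseteq> {c \<in> carrier free. ext c = \<zero>\<^bsub>U\<^esub>}"
    unfolding tensor_kernel_def
    by (rule module_span_minimal[OF submodule_kernel[OF F.module_axioms U linear_map_tensor_ext]])
  then show "c \<in> carrier free" "ext c = \<zero>\<^bsub>U\<^esub>"
    using assms by auto
qed

text \<open>Here \<open>the_elem\<close> acquires its meaning: the extension is constant on a coset
  by \<open>tensor_kernel_ext\<close>, and the coset is non-empty because the kernel contains zero,
  so the image is a singleton.\<close>

lemma tensor_lift_coset:
  assumes c: "c \<in> carrier free"
  shows "tensor_lift K U f (ker +>\<^bsub>free\<^esub> c) = ext c"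
proof -
  have "ext ` (ker +>\<^bsub>free\<^esub> c) = {ext c}"
  proof -
    have "ext (n \<oplus>\<^bsub>free\<^esub> c) = ext c" if "n \<in> ker" for n
      using tensor_kernel_ext[OF that] c linear_map_closed[OF linear_map_tensor_ext c]
      by (simp add: linear_map_add[OF linear_map_tensor_ext])
    then have "(\<lambda>n. ext (n \<oplus>\<^bsub>free\<^esub> c)) ` ker = (\<lambda>n. ext c) ` ker"
      by (rule image_cong[OF refl])
    also have "\<dots> = {ext c}"
      using submodule_zero_mem[OF submodule_tensor_kernel] by auto
    finally show ?thesis
      by (simp add: a_r_coset_def' UNION_singleton_eq_range image_image)
  qed
  then show ?thesis
    unfolding tensor_lift_def linear_extension_def[symmetric] by simp
qed

lemma tensor_lift_pure:
  "\<lbrakk>x \<in> carrier V; y \<in> carrier W\<rbrakk> \<Longrightarrow> tensor_lift K U f (pure_tensor K V W x y) = f x y"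
  unfolding pure_tensor_def by (simp add: tensor_lift_coset free_gen_pair_closed tensor_ext_gen)

lemma linear_map_tensor_lift: "linear_map K tensor U (tensor_lift K U f)"
proof (rule linear_mapI)
  interpret T: module K tensor by (rule module_tensor_product)
  note proj_add = linear_map_add[OF linear_map_tensor_proj, symmetric]
    and proj_smult = linear_map_smult[OF linear_map_tensor_proj, symmetric]
    and ext = linear_map_closed[OF linear_map_tensor_ext] linear_map_add[OF linear_map_tensor_ext]
      linear_map_smult[OF linear_map_tensor_ext]
  fix u assume "u \<in> carrier tensor"
  then obtain c where c: "c \<in> carrier free" "u = ker +>\<^bsub>free\<^esub> c" by (rule tensor_carrierE)
  then show "tensor_lift K U f u \<in> carrier U" by (simp add: tensor_lift_coset ext)
  show "tensor_lift K U f (a \<odot>\<^bsub>tensor\<^esub> u) = a \<odot>\<^bsub>U\<^esub> tensor_lift K U f u"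
    if "a \<in> carrier K" for a
    using c that by (simp add: proj_smult tensor_lift_coset ext)
  fix v assume "v \<in> carrier tensor"
  then obtain d where "d \<in> carrier free" "v = ker +>\<^bsub>free\<^esub> d" by (rule tensor_carrierE)
  then show "tensor_lift K U f (u \<oplus>\<^bsub>tensor\<^esub> v) = tensor_lift K U f u \<oplus>\<^bsub>U\<^esub> tensor_lift K U f v"
    using c by (simp add: proj_add tensor_lift_coset ext)
qed

end

end

text \<open>The nesting matches the definition of the current bracket. The form built from
  \<open>\<alpha>\<close> is a second instance, with scalar values.\<close>

definition tensor_lift2 ::
    "('k, 'r) ring_scheme \<Rightarrow> ('k, 'u, 'l) module_scheme \<Rightarrow> ('v \<Rightarrow> 'w \<Rightarrow> 'x \<Rightarrow> 'y \<Rightarrow> 'u)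
      \<Rightarrow> ('v \<times> 'w \<Rightarrow> 'k) set \<Rightarrow> ('x \<times> 'y \<Rightarrow> 'k) set \<Rightarrow> 'u"
  where "tensor_lift2 K U h u v = tensor_lift K U (\<lambda>x s. tensor_lift K U (h x s) v) u"

context
  fixes K :: "('k, 'r) ring_scheme"
    and V :: "('k, 'v, 'm) module_scheme"
    and W :: "('k, 'w, 'n) module_scheme"
    and X :: "('k, 'x, 'o) module_scheme"
    and Y :: "('k, 'y, 'p) module_scheme"
    and U :: "('k, 'u, 'l) module_scheme" and h :: "'v \<Rightarrow> 'w \<Rightarrow> 'x \<Rightarrow> 'y \<Rightarrow> 'u"
  assumes V: "module K V" and W: "module K W" and X: "module K X" and Y: "module K Y"
    and U: "module K U"
    and inner: "\<And>x s. \<lbrakk>x \<in> carrier V; s \<in> carrier W\<rbrakk> \<Longrightarrow> bilinear_map K X Y U (h x s)"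
    and outer: "\<And>y t. \<lbrakk>y \<in> carrier X; t \<in> carrier Y\<rbrakk> \<Longrightarrow> bilinear_map K V W U (\<lambda>x s. h x s y t)"
begin

interpretation V: module K V by (rule V)
interpretation W: module K W by (rule W)

text \<open>The outer lift needs bilinearity in \<open>x\<close> and \<open>s\<close> for an
  arbitrary tensor \<open>v\<close>. Both sides of each law are linear in \<open>v\<close>, and on
  pure \<open>v\<close> the law is the hypothesis \<open>outer\<close>.\<close>

lemma tensor_lift_bilinear_family:
  assumes v: "v \<in> carrier (tensor_product K X Y)"
  shows "bilinear_map K V W U (\<lambda>x s. tensor_lift K U (h x s) v)"
proof -
  note lin = linear_map_tensor_lift[OF X Y U inner]
    and pure = tensor_lift_pure[OF X Y U inner]
    and eqI = tensor_linear_map_eqI[OF X Y U _ _ _ v]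
    and add_l = linear_map_add[OF bilinear_map_left[OF outer]]
    and add_r = linear_map_add[OF bilinear_map_right[OF outer]]
    and smult_l = linear_map_smult[OF bilinear_map_left[OF outer]]
    and smult_r = linear_map_smult[OF bilinear_map_right[OF outer]]
  show ?thesis
    unfolding bilinear_map_def
  proof (intro conjI ballI linear_mapI)
    fix x s assume xs: "x \<in> carrier V" "s \<in> carrier W"
    show "tensor_lift K U (h x s) v \<in> carrier U"
      by (rule linear_map_closed[OF lin[OF xs] v])
    then show "tensor_lift K U (h x s) v \<in> carrier U" .
    fix a assume a: "a \<in> carrier K"
    show "tensor_lift K U (h x (a \<odot>\<^bsub>W\<^esub> s)) v = a \<odot>\<^bsub>U\<^esub> tensor_lift K U (h x s) v"
      using xs a
      by (intro eqI[where h = "\<lambda>v. a \<odot>\<^bsub>U\<^esub> tensor_lift K U (h x s) v"] lin linear_map_scale U)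
         (simp_all add: pure smult_r)
    show "tensor_lift K U (h (a \<odot>\<^bsub>V\<^esub> x) s) v = a \<odot>\<^bsub>U\<^esub> tensor_lift K U (h x s) v"
      using xs a
      by (intro eqI[where h = "\<lambda>v. a \<odot>\<^bsub>U\<^esub> tensor_lift K U (h x s) v"] lin linear_map_scale U)
         (simp_all add: pure smult_l)
  next
    fix x s s' assume xs: "x \<in> carrier V" "s \<in> carrier W" "s' \<in> carrier W"
    then show "tensor_lift K U (h x (s \<oplus>\<^bsub>W\<^esub> s')) v
        = tensor_lift K U (h x s) v \<oplus>\<^bsub>U\<^esub> tensor_lift K U (h x s') v"
      by (intro eqI[where h = "\<lambda>v. tensor_lift K U (h x s) v \<oplus>\<^bsub>U\<^esub> tensor_lift K U (h x s') v"]
            lin linear_map_plus U)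
         (simp_all add: pure add_r)
  next
    fix s x x' assume xs: "s \<in> carrier W" "x \<in> carrier V" "x' \<in> carrier V"
    then show "tensor_lift K U (h (x \<oplus>\<^bsub>V\<^esub> x') s) v
        = tensor_lift K U (h x s) v \<oplus>\<^bsub>U\<^esub> tensor_lift K U (h x' s) v"
      by (intro eqI[where h = "\<lambda>v. tensor_lift K U (h x s) v \<oplus>\<^bsub>U\<^esub> tensor_lift K U (h x' s) v"]
            lin linear_map_plus U)
         (simp_all add: pure add_l)
  qed
qed

lemma tensor_lift2_pure_left:
  assumes "x \<in> carrier V" "s \<in> carrier W" "v \<in> carrier (tensor_product K X Y)"
  shows "tensor_lift2 K U h (pure_tensor K V W x s) v = tensor_lift K U (h x s) v"
  unfolding tensor_lift2_def
  by (rule tensor_lift_pure[OF V W U tensor_lift_bilinear_family]) (use assms in auto)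

lemma tensor_lift2_pure:
  assumes "x \<in> carrier V" "s \<in> carrier W" "y \<in> carrier X" "t \<in> carrier Y"
  shows "tensor_lift2 K U h (pure_tensor K V W x s) (pure_tensor K X Y y t) = h x s y t"
  using assms
  by (simp add: tensor_lift2_pure_left pure_tensor_closed[OF X Y] tensor_lift_pure[OF X Y U inner])

text \<open>Linearity in \<open>u\<close> is that of the outer lift. Linearity in \<open>v\<close>
  is hidden under the outer lift, so each law is read as an equality of linear maps in
  \<open>u\<close>; on pure \<open>u\<close> it is linearity of the inner lift.\<close>

lemma bilinear_map_tensor_lift2:
  "bilinear_map K (tensor_product K V W) (tensor_product K X Y) U (tensor_lift2 K U h)"
proof -
  interpret T: module K "tensor_product K X Y" by (rule module_tensor_product[OF X Y])
  have left: "linear_map K (tensor_product K V W) U (\<lambda>u. tensor_lift2 K U h u v)"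
    if "v \<in> carrier (tensor_product K X Y)" for v
    unfolding tensor_lift2_def
    by (rule linear_map_tensor_lift[OF V W U tensor_lift_bilinear_family[OF that]])
  note eqI = tensor_linear_map_eqI[OF V W U left]
  have "linear_map K (tensor_product K X Y) U (tensor_lift2 K U h u)"
    if u: "u \<in> carrier (tensor_product K V W)" for u
  proof (rule linear_mapI)
    fix v assume v: "v \<in> carrier (tensor_product K X Y)"
    show "tensor_lift2 K U h u v \<in> carrier U"
      by (rule linear_map_closed[OF left[OF v] u])
    show "tensor_lift2 K U h u (a \<odot>\<^bsub>tensor_product K X Y\<^esub> v) = a \<odot>\<^bsub>U\<^esub> tensor_lift2 K U h u v"
      if a: "a \<in> carrier K" for a
      by (rule eqI[OF _ linear_map_scale[OF U left[OF v] a] _ u])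
         (use v a in \<open>simp_all add: tensor_lift2_pure_left
            linear_map_smult[OF linear_map_tensor_lift[OF X Y U inner]]\<close>)
    fix w assume w: "w \<in> carrier (tensor_product K X Y)"
    show "tensor_lift2 K U h u (v \<oplus>\<^bsub>tensor_product K X Y\<^esub> w)
        = tensor_lift2 K U h u v \<oplus>\<^bsub>U\<^esub> tensor_lift2 K U h u w"
      by (rule eqI[OF _ linear_map_plus[OF U left[OF v] left[OF w]] _ u])
         (use v w in \<open>simp_all add: tensor_lift2_pure_left
            linear_map_add[OF linear_map_tensor_lift[OF X Y U inner]]\<close>)
  qed
  then show ?thesis using left by (simp add: bilinear_map_def)
qed

end


section \<open>Representation of functionals by a non-degenerate form\<close>

locale nondegenerate_symmetric_form = K: field K + V: module K V
  for K :: "('k, 'r) ring_scheme" (structure) and V :: "('k, 'v, 'm) module_scheme" +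
  fixes B :: "'v \<Rightarrow> 'v \<Rightarrow> 'k"
  assumes form_bilinear: "bilinear_map K V V (self_module K) B"
    and form_sym: "\<lbrakk>x \<in> carrier V; y \<in> carrier V\<rbrakk> \<Longrightarrow> B x y = B y x"
    and form_nondegenerate:
      "\<lbrakk>x \<in> carrier V; \<And>y. y \<in> carrier V \<Longrightarrow> B x y = \<zero>\<rbrakk> \<Longrightarrow> x = \<zero>\<^bsub>V\<^esub>"
begin

lemma form_left: "y \<in> carrier V \<Longrightarrow> linear_map K V (self_module K) (\<lambda>x. B x y)"
  by (rule bilinear_map_left[OF form_bilinear])

lemma form_right: "x \<in> carrier V \<Longrightarrow> linear_map K V (self_module K) (B x)"
  by (rule bilinear_map_right[OF form_bilinear])

lemma form_closed [simp]: "\<lbrakk>x \<in> carrier V; y \<in> carrier V\<rbrakk> \<Longrightarrow> B x y \<in> carrier K"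
  using linear_map_closed[OF form_left] by simp

lemma form_add_left:
  "\<lbrakk>x \<in> carrier V; y \<in> carrier V; z \<in> carrier V\<rbrakk> \<Longrightarrow> B (x \<oplus>\<^bsub>V\<^esub> y) z = B x z \<oplus> B y z"
  using linear_map_add[OF form_left] by simp

lemma form_add_right:
  "\<lbrakk>x \<in> carrier V; y \<in> carrier V; z \<in> carrier V\<rbrakk> \<Longrightarrow> B x (y \<oplus>\<^bsub>V\<^esub> z) = B x y \<oplus> B x z"
  using linear_map_add[OF form_right] by simp

lemma form_smult_left:
  "\<lbrakk>a \<in> carrier K; x \<in> carrier V; y \<in> carrier V\<rbrakk> \<Longrightarrow> B (a \<odot>\<^bsub>V\<^esub> x) y = a \<otimes> B x y"
  using linear_map_smult[OF form_left] by simp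

lemma form_smult_right:
  "\<lbrakk>a \<in> carrier K; x \<in> carrier V; y \<in> carrier V\<rbrakk> \<Longrightarrow> B x (a \<odot>\<^bsub>V\<^esub> y) = a \<otimes> B x y"
  using linear_map_smult[OF form_right] by simp

lemma form_zero_left: "x \<in> carrier V \<Longrightarrow> B \<zero>\<^bsub>V\<^esub> x = \<zero>"
  using linear_map_zero[OF V.module_axioms K.module_self_module form_left] by simp

text \<open>The working form of non-degeneracy: vectors are identified through their pairings, by
  applying the axiom to their difference.\<close>

lemma form_eqI:
  assumes "x \<in> carrier V" "x' \<in> carrier V" "\<And>y. y \<in> carrier V \<Longrightarrow> B x y = B x' y"
  shows "x = x'"
proof -
  have "B (x \<ominus>\<^bsub>V\<^esub> x') y = \<zero>" if y: "y \<in> carrier V" for y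
  proof -
    have "B (x \<ominus>\<^bsub>V\<^esub> x') y = B x y \<ominus>\<^bsub>self_module K\<^esub> B x' y"
      by (rule linear_map_minus[OF V.module_axioms K.module_self_module form_left[OF y]]) fact+
    also have "\<dots> = \<zero>"
      using assms y module.axioms(2)[OF K.module_self_module]
        abelian_group.minus_eq_zero_iff[of "self_module K" "B x y" "B x' y"] by simp
    finally show ?thesis .
  qed
  then have "x \<ominus>\<^bsub>V\<^esub> x' = \<zero>\<^bsub>V\<^esub>"
    using assms by (intro form_nondegenerate) auto
  then show ?thesis using assms by (simp add: V.minus_eq_zero_iff)
qed

lemma double_orthogonal_mem:
  assumes H: "submodule H K V" and "finite A" "A \<subseteq> H" "x \<in> carrier V"
    and "\<And>z. \<lbrakk>z \<in> carrier V; \<And>a. a \<in> A \<Longrightarrow> B z a = \<zero>\<rbrakk> \<Longrightarrow> B z x = \<zero>"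
  shows "x \<in> H"
  using assms(2-)
proof (induction A arbitrary: x rule: finite_induct)
  case empty
  then have "B x z = \<zero>" if "z \<in> carrier V" for z
    using that by (simp add: form_sym[of x])
  then have "x = \<zero>\<^bsub>V\<^esub>" using empty by (intro form_nondegenerate)
  then show ?case using submodule_zero_mem[OF H] by simp
next
  case (insert a A)
  have AV: "a \<in> carrier V" "A \<subseteq> carrier V" "a \<in> H" "A \<subseteq> H"
    using insert.prems(1) V.submoduleE(1)[OF H] by auto
  show ?case
  proof (cases "\<forall>z\<in>carrier V. (\<forall>b\<in>A. B z b = \<zero>) \<longrightarrow> B z a = \<zero>")
    case True
    show ?thesis
    proof (rule insert.IH[OF AV(4) insert.prems(2)])
      show "B z x = \<zero>" if "z \<in> carrier V" "\<And>b. b \<in> A \<Longrightarrow> B z b = \<zero>" for z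
        using True that by (intro insert.prems(3)) auto
    qed
  next
    case False
    then obtain w where w: "w \<in> carrier V" "\<And>b. b \<in> A \<Longrightarrow> B w b = \<zero>" "B w a \<noteq> \<zero>" by blast
    \<comment> \<open>The coefficient for which \<open>x\<close> minus \<open>c\<close> times
      \<open>a\<close> is orthogonal to \<open>w\<close>.\<close>
    define c where "c = inv (B w a) \<otimes> B w x"
    have inv: "inv (B w a) \<in> carrier K" "inv (B w a) \<otimes> B w a = \<one>"
      using w AV K.field_Units by auto
    have c: "c \<in> carrier K" using inv w insert.prems(2) by (simp add: c_def)
    have "x \<ominus>\<^bsub>V\<^esub> c \<odot>\<^bsub>V\<^esub> a \<in> H"
    proof (rule insert.IH[OF AV(4)])
      show "x \<ominus>\<^bsub>V\<^esub> c \<odot>\<^bsub>V\<^esub> a \<in> carrier V" using c AV insert.prems(2) by auto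
      fix z assume z: "z \<in> carrier V" "\<And>b. b \<in> A \<Longrightarrow> B z b = \<zero>"
      \<comment> \<open>The coefficient for which \<open>z\<close> plus \<open>d\<close> times
        \<open>w\<close> is orthogonal to \<open>a\<close>. Orthogonality to \<open>A\<close>
        survives, as both \<open>z\<close> and \<open>w\<close> have it, so the hypothesis on
        \<open>x\<close> applies to the corrected vector.\<close>
      define d where "d = \<ominus> (B z a \<otimes> inv (B w a))"
      have d: "d \<in> carrier K" using inv z AV by (simp add: d_def)
      have "B (z \<oplus>\<^bsub>V\<^esub> d \<odot>\<^bsub>V\<^esub> w) x = \<zero>"
      proof (rule insert.prems(3))
        show "z \<oplus>\<^bsub>V\<^esub> d \<odot>\<^bsub>V\<^esub> w \<in> carrier V" using z w d by simp
        fix b assume "b \<in> insert a A"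
        then consider "b = a" | "b \<in> A" by auto
        then show "B (z \<oplus>\<^bsub>V\<^esub> d \<odot>\<^bsub>V\<^esub> w) b = \<zero>"
        proof cases
          case 1
          have "B (z \<oplus>\<^bsub>V\<^esub> d \<odot>\<^bsub>V\<^esub> w) a = B z a \<oplus> d \<otimes> B w a"
            using z w d AV by (simp add: form_add_left form_smult_left)
          also have "d \<otimes> B w a = \<ominus> (B z a)"
            using z w inv AV by (simp add: d_def K.l_minus K.m_assoc)
          finally show ?thesis using z AV 1 by (simp add: K.r_neg)
        next
          case 2
          then have "b \<in> carrier V" using AV by auto
          then show ?thesis using 2 z w d by (simp add: form_add_left form_smult_left)
        qed
      qed
      then have 0: "B z x \<oplus> d \<otimes> B w x = \<zero>"
        using z w d insert.prems(2) by (simp add: form_add_left form_smult_left)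
      have "B z (x \<ominus>\<^bsub>V\<^esub> c \<odot>\<^bsub>V\<^esub> a) = B z x \<oplus> \<ominus> c \<otimes> B z a"
        using z c AV insert.prems(2)
        by (simp add: a_minus_def form_add_right form_smult_right
            V.smult_l_minus[symmetric])
      \<comment> \<open>Both sides equal minus the product of \<open>B z a\<close>,
        \<open>inv (B w a)\<close> and \<open>B w x\<close>: correcting \<open>x\<close> by
        \<open>a\<close> changes the pairing exactly as correcting \<open>z\<close> by
        \<open>w\<close> does.\<close>
      also have "\<ominus> c \<otimes> B z a = d \<otimes> B w x"
        using z c d w inv AV insert.prems(2)
        by (simp add: c_def d_def K.l_minus K.r_minus K.m_ac)
      finally show "B z (x \<ominus>\<^bsub>V\<^esub> c \<odot>\<^bsub>V\<^esub> a) = \<zero>" using 0 by simp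
    qed
    then have "(x \<ominus>\<^bsub>V\<^esub> c \<odot>\<^bsub>V\<^esub> a) \<oplus>\<^bsub>V\<^esub> c \<odot>\<^bsub>V\<^esub> a \<in> H"
      using V.submoduleE(4,5)[OF H] AV c by blast
    then show ?thesis
      using insert.prems(2) c AV by (simp add: a_minus_def V.a_assoc V.l_neg)
  qed
qed

text \<open>The representing vector is corrected one spanning vector at a time. An obstruction would
  be a vector \<open>a\<close> at which the value of \<open>B z\<close> cannot be changed without
  disturbing the earlier ones; \<open>double_orthogonal_mem\<close> shows that then
  \<open>B z a\<close> is already right.\<close>

lemma riesz_representation:
  assumes "finite_dimensional K V" and f: "linear_map K V (self_module K) f"
  shows "\<exists>z\<in>carrier V. \<forall>y\<in>carrier V. f y = B z y"
proof -
  have equalizer: "submodule {y \<in> carrier V. f y = B z y} K V" if "z \<in> carrier V" for z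
    by (rule submodule_equalizer[OF V.module_axioms K.module_self_module f form_right[OF that]])
  have f_closed: "f y \<in> carrier K" if "y \<in> carrier V" for y
    using linear_map_closed[OF f that] by simp
  obtain A where A: "finite A" "A \<subseteq> carrier V" "module_span K V A = carrier V"
    using assms(1) by (auto simp: finite_dimensional_def)
  have "\<exists>z\<in>carrier V. \<forall>a\<in>A. f a = B z a"
    using A(1,2)
  proof (induction A rule: finite_induct)
    case empty
    then show ?case by auto
  next
    case (insert a A)
    then obtain z where z: "z \<in> carrier V" "\<forall>b\<in>A. f b = B z b" by auto
    have a: "a \<in> carrier V" and A: "A \<subseteq> carrier V" using insert.prems by auto
    show ?case
    proof (cases "\<forall>w\<in>carrier V. (\<forall>b\<in>A. B w b = \<zero>) \<longrightarrow> B w a = \<zero>")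
      case True
      \<comment> \<open>The submodule supplied to \<open>double_orthogonal_mem\<close> is the
        equalizer of \<open>f\<close> and \<open>B z\<close>: it contains \<open>A\<close>, hence
        also \<open>a\<close>.\<close>
      have "a \<in> {y \<in> carrier V. f y = B z y}"
      proof (rule double_orthogonal_mem[OF equalizer[OF z(1)] insert.hyps(1) _ a])
        show "A \<subseteq> {y \<in> carrier V. f y = B z y}" using A z by auto
        show "B w a = \<zero>" if "w \<in> carrier V" "\<And>b. b \<in> A \<Longrightarrow> B w b = \<zero>" for w
          using True that by auto
      qed
      then show ?thesis using z by auto
    next
      case False
      then obtain w where w: "w \<in> carrier V" "\<And>b. b \<in> A \<Longrightarrow> B w b = \<zero>" "B w a \<noteq> \<zero>"
        by blast
      have inv: "inv (B w a) \<in> carrier K" "inv (B w a) \<otimes> B w a = \<one>"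
        using w a K.field_Units by auto
      \<comment> \<open>The multiple of \<open>w\<close> that repairs the value at \<open>a\<close>;
        since \<open>w\<close> is orthogonal to \<open>A\<close>, the values already matched do not
        change.\<close>
      define c where "c = (f a \<ominus> B z a) \<otimes> inv (B w a)"
      have c: "c \<in> carrier K" using inv z a f_closed by (simp add: c_def)
      have "f b = B (z \<oplus>\<^bsub>V\<^esub> c \<odot>\<^bsub>V\<^esub> w) b" if b: "b \<in> insert a A" for b
      proof -
        have bV: "b \<in> carrier V" using b a A by auto
        then have *: "B (z \<oplus>\<^bsub>V\<^esub> c \<odot>\<^bsub>V\<^esub> w) b = B z b \<oplus> c \<otimes> B w b"
          using z w c by (simp add: form_add_left form_smult_left)
        show ?thesis
        proof (cases "b = a")
          case True
          have "c \<otimes> B w a = f a \<ominus> B z a"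
            using inv z w a f_closed by (simp add: c_def K.m_assoc)
          then show ?thesis
            using * True z a f_closed by (simp add: a_minus_def K.a_ac K.r_neg)
        next
          case False
          then show ?thesis using * b z w c bV by auto
        qed
      qed
      then show ?thesis using z w c by (intro bexI[of _ "z \<oplus>\<^bsub>V\<^esub> c \<odot>\<^bsub>V\<^esub> w"]) auto
    qed
  qed
  then obtain z where z: "z \<in> carrier V" "\<forall>a\<in>A. f a = B z a" by auto
  then have "module_span K V A \<subseteq> {y \<in> carrier V. f y = B z y}"
    using A by (intro module_span_minimal equalizer) auto
  then show ?thesis using A z by auto
qed

text \<open>Representing vectors are chosen pointwise. Non-degeneracy makes them unique, so
  linearity of \<open>\<phi>\<close> in its first argument passes to the choice. This yields both
  the adjoints and the maps \<open>\<alpha> s t\<close>.\<close>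

lemma riesz_bilinear:
  assumes "finite_dimensional K V" "module K U" and \<phi>: "bilinear_map K U V (self_module K) \<phi>"
  shows "\<exists>T. T \<in> extensional (carrier U) \<and> linear_map K U V T \<and>
    (\<forall>u\<in>carrier U. \<forall>y\<in>carrier V. B (T u) y = \<phi> u y)"
proof -
  interpret U: module K U by fact
  have "\<forall>u\<in>carrier U. \<exists>z. z \<in> carrier V \<and> (\<forall>y\<in>carrier V. B z y = \<phi> u y)"
    using riesz_representation[OF assms(1) bilinear_map_right[OF \<phi>]] by metis
  then obtain T0 where T0: "\<And>u. u \<in> carrier U \<Longrightarrow> T0 u \<in> carrier V"
    "\<And>u y. \<lbrakk>u \<in> carrier U; y \<in> carrier V\<rbrakk> \<Longrightarrow> B (T0 u) y = \<phi> u y"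
    by metis
  \<comment> \<open>The restriction gives the extensionality that \<open>centroid\<close> and
    \<open>form_adjoint\<close> demand.\<close>
  define T where "T = restrict T0 (carrier U)"
  have T: "T u \<in> carrier V" "B (T u) y = \<phi> u y" if "u \<in> carrier U" "y \<in> carrier V" for u y
    using T0 that by (auto simp: T_def)
  have TV: "T u \<in> carrier V" if "u \<in> carrier U" for u
    using T0 that by (auto simp: T_def)
  have "linear_map K U V T"
  proof (rule linear_mapI)
    fix u v assume u: "u \<in> carrier U" and v: "v \<in> carrier U"
    show "T (u \<oplus>\<^bsub>U\<^esub> v) = T u \<oplus>\<^bsub>V\<^esub> T v"
      using u v linear_map_add[OF bilinear_map_left[OF \<phi>]]
      by (intro form_eqI) (simp_all add: TV T form_add_left)
  next
    fix a u assume "a \<in> carrier K" "u \<in> carrier U"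
    then show "T (a \<odot>\<^bsub>U\<^esub> u) = a \<odot>\<^bsub>V\<^esub> T u"
      using linear_map_smult[OF bilinear_map_left[OF \<phi>]]
      by (intro form_eqI) (simp_all add: TV T form_smult_left)
  qed (rule TV)
  then show ?thesis using T by (intro exI[of _ T]) (auto simp: T_def)
qed

text \<open>Evaluates the definite description: by non-degeneracy two adjoints agree on the carrier,
  and extensionality settles their values outside it.\<close>

lemma form_adjoint_eqI:
  assumes "T' \<in> extensional (carrier V)" "linear_map K V V T'"
    and "\<And>x y. \<lbrakk>x \<in> carrier V; y \<in> carrier V\<rbrakk> \<Longrightarrow> B (T x) y = B x (T' y)"
  shows "form_adjoint K V B T = T'"
  unfolding form_adjoint_def
proof (rule the_equality)
  show "T'' = T'" if "T'' \<in> extensional (carrier V) \<and> linear_map K V V T'' \<and>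
    (\<forall>x\<in>carrier V. \<forall>y\<in>carrier V. B (T x) y = B x (T'' y))" for T''
  proof (rule extensionalityI[of _ "carrier V"])
    fix y assume y: "y \<in> carrier V"
    have closed: "T'' y \<in> carrier V" "T' y \<in> carrier V"
      using that assms y by (auto intro: linear_map_closed)
    have "B x (T'' y) = B x (T' y)" if x: "x \<in> carrier V" for x
      using that \<open>T'' \<in> _ \<and> _\<close> assms(3)[OF x y] x y by metis
    then show "T'' y = T' y"
      using closed by (intro form_eqI) (simp_all add: form_sym[of "T'' y"] form_sym[of "T' y"])
  qed (use that assms in auto)
qed (use assms in auto)

lemma form_adjoint:
  assumes "finite_dimensional K V" "linear_map K V V T" "x \<in> carrier V" "y \<in> carrier V"
  shows "B (T x) y = B x (form_adjoint K V B T y)"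
proof -
  \<comment> \<open>The variables are swapped so that for fixed \<open>y\<close> the functional in
    \<open>x\<close> is represented by a vector, which becomes the value of the adjoint at
    \<open>y\<close>.\<close>
  have "bilinear_map K V V (self_module K) (\<lambda>y x. B (T x) y)"
    unfolding bilinear_map_def
    using linear_map_comp[OF form_left assms(2)] form_right linear_map_closed[OF assms(2)] by auto
  from riesz_bilinear[OF assms(1) V.module_axioms this] obtain T' where
    T': "T' \<in> extensional (carrier V)" "linear_map K V V T'"
      "\<And>x y. \<lbrakk>x \<in> carrier V; y \<in> carrier V\<rbrakk> \<Longrightarrow> B (T' y) x = B (T x) y"
    by blast
  have "B (T x) y = B x (T' y)" if "x \<in> carrier V" "y \<in> carrier V" for x y
    using T'(3)[OF that] form_sym[of x "T' y"] that linear_map_closed[OF T'(2)] by auto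
  then show ?thesis
    using form_adjoint_eqI[OF T'(1,2)] assms(3,4) by auto
qed

end


section \<open>Invariant metrics on current Lie algebras\<close>

lemma centroid_simps:
  "zero (centroid K L) = (\<lambda>x\<in>carrier L. \<zero>\<^bsub>L\<^esub>)"
  "add (centroid K L) = (\<lambda>T T'. \<lambda>x\<in>carrier L. T x \<oplus>\<^bsub>L\<^esub> T' x)"
  "smult (centroid K L) = (\<lambda>a T. \<lambda>x\<in>carrier L. a \<odot>\<^bsub>L\<^esub> T x)"
  by (simp_all add: centroid_def)

lemma centroid_carrier:
  "T \<in> carrier (centroid K L) \<longleftrightarrow> T \<in> extensional (carrier L) \<and> linear_map K L L T \<and>
    (\<forall>x\<in>carrier L. \<forall>y\<in>carrier L. T (bracket L x y) = bracket L (T x) y)"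
  by (simp add: centroid_def)

text \<open>Operations in the centroid are pointwise. Composing with evaluation at \<open>x\<close>
  turns bilinearity of \<open>\<alpha>\<close> into linearity of \<open>\<alpha> s t x\<close> in
  each scalar index.\<close>

lemma linear_map_centroid_eval:
  "x \<in> carrier L \<Longrightarrow> linear_map K (centroid K L) L (\<lambda>T. T x)"
  by (rule linear_mapI) (simp_all add: centroid_simps centroid_carrier linear_map_closed[of K L L])

lemma current_lie_algebra_simps:
  "carrier (current_lie_algebra K L S) = carrier (tensor_product K L S)"
  "zero (current_lie_algebra K L S) = zero (tensor_product K L S)"
  "add (current_lie_algebra K L S) = add (tensor_product K L S)"
  "smult (current_lie_algebra K L S) = smult (tensor_product K L S)"
  "bracket (current_lie_algebra K L S) = tensor_lift2 K (tensor_product K L S)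
    (\<lambda>x s y t. pure_tensor K L S (bracket L x y) (s \<otimes>\<^bsub>S\<^esub> t))"
  by (simp_all add: current_lie_algebra_def Let_def module.defs lie_algebra.defs
      tensor_lift2_def fun_eq_iff)

lemma linear_map_current_lie_algebra:
  "linear_map K (current_lie_algebra K L S) U h \<longleftrightarrow> linear_map K (tensor_product K L S) U h"
  by (simp add: linear_map_def current_lie_algebra_simps)

lemma bilinear_map_current_lie_algebra:
  "bilinear_map K (current_lie_algebra K L S) (current_lie_algebra K L S) U h \<longleftrightarrow>
    bilinear_map K (tensor_product K L S) (tensor_product K L S) U h"
  by (simp add: bilinear_map_def linear_map_current_lie_algebra current_lie_algebra_simps)

locale current_algebra =
  nondegenerate_symmetric_form K L B + S: algebra K S
  for K :: "('k, 'r) ring_scheme" (structure) and L :: "('k, 'g, 'l) lie_algebra_scheme"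
    and S :: "('k, 's, 'n) module_scheme" and B :: "'g \<Rightarrow> 'g \<Rightarrow> 'k" +
  assumes bracket_bilinear: "bilinear_map K L L L (bracket L)"
    and form_invariant: "\<lbrakk>x \<in> carrier L; y \<in> carrier L; z \<in> carrier L\<rbrakk> \<Longrightarrow>
      B x (bracket L y z) = B (bracket L x y) z"
    and fin_dim: "finite_dimensional K L"
begin

section \<open>The bracket of the current algebra on pure tensors\<close>

abbreviation pure (infixl \<open>\<otimes>\<otimes>\<close> 70) where "x \<otimes>\<otimes> s \<equiv> pure_tensor K L S x s"
abbreviation T where "T \<equiv> tensor_product K L S"
abbreviation current_bracket where "current_bracket \<equiv> bracket (current_lie_algebra K L S)"

sublocale T: module K T
  by (rule module_tensor_product[OF V.module_axioms S.module_axioms])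

lemmas pure_bilinear = bilinear_map_pure_tensor[OF V.module_axioms S.module_axioms]
lemmas pure_closed = pure_tensor_closed[OF V.module_axioms S.module_axioms]
lemmas tensor_eqI = tensor_linear_map_eqI[OF V.module_axioms S.module_axioms]

lemma bracket_closed: "\<lbrakk>x \<in> carrier L; y \<in> carrier L\<rbrakk> \<Longrightarrow> bracket L x y \<in> carrier L"
  by (rule bilinear_map_closed[OF bracket_bilinear])

lemma mult_bilinear: "bilinear_map K S S S (\<otimes>\<^bsub>S\<^esub>)"
proof -
  \<comment> \<open>The algebra axiom moves a scalar out of the left factor; commutativity of
    \<open>S\<close> handles the right one.\<close>
  have "s \<otimes>\<^bsub>S\<^esub> (a \<odot>\<^bsub>S\<^esub> t) = a \<odot>\<^bsub>S\<^esub> (s \<otimes>\<^bsub>S\<^esub> t)"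
    if "a \<in> carrier K" "s \<in> carrier S" "t \<in> carrier S" for a s t
    using that S.smult_assoc2[of a t s] S.smult_closed[of a t]
    by (simp add: S.m_comm)
  then show ?thesis
    by (auto simp: bilinear_map_def S.smult_assoc2 S.l_distr S.r_distr intro!: linear_mapI)
qed

text \<open>These are the \<open>inner\<close> and \<open>outer\<close> hypotheses that the double
  lift requires for the current bracket.\<close>

lemma bilinear_bracket_pure:
  shows "\<lbrakk>x \<in> carrier L; s \<in> carrier S\<rbrakk> \<Longrightarrow>
      bilinear_map K L S T (\<lambda>y t. bracket L x y \<otimes>\<otimes> (s \<otimes>\<^bsub>S\<^esub> t))"
    and "\<lbrakk>y \<in> carrier L; t \<in> carrier S\<rbrakk> \<Longrightarrow>
      bilinear_map K L S T (\<lambda>x s. bracket L x y \<otimes>\<otimes> (s \<otimes>\<^bsub>S\<^esub> t))"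
proof -
  note lin = bilinear_map_left[OF pure_bilinear] bilinear_map_right[OF pure_bilinear]
    bilinear_map_left[OF bracket_bilinear] bilinear_map_right[OF bracket_bilinear]
    bilinear_map_left[OF mult_bilinear] bilinear_map_right[OF mult_bilinear]
  show "bilinear_map K L S T (\<lambda>y t. bracket L x y \<otimes>\<otimes> (s \<otimes>\<^bsub>S\<^esub> t))"
    if "x \<in> carrier L" "s \<in> carrier S"
    unfolding bilinear_map_def using that
    by (auto intro: linear_map_comp[OF lin(1,3)] linear_map_comp[OF lin(2,6)]
        linear_map_comp[OF lin(1,4)] bracket_closed)
  show "bilinear_map K L S T (\<lambda>x s. bracket L x y \<otimes>\<otimes> (s \<otimes>\<^bsub>S\<^esub> t))"
    if "y \<in> carrier L" "t \<in> carrier S"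
    unfolding bilinear_map_def using that
    by (auto intro: linear_map_comp[OF lin(1,3)] linear_map_comp[OF lin(2,5)] bracket_closed)
qed

lemma current_bracket_bilinear: "bilinear_map K T T T current_bracket"
  unfolding current_lie_algebra_simps
  by (intro bilinear_map_tensor_lift2 V.module_axioms S.module_axioms T.module_axioms
      bilinear_bracket_pure)

lemma current_bracket_pure:
  "\<lbrakk>x \<in> carrier L; s \<in> carrier S; y \<in> carrier L; t \<in> carrier S\<rbrakk> \<Longrightarrow>
    current_bracket (x \<otimes>\<otimes> s) (y \<otimes>\<otimes> t) = bracket L x y \<otimes>\<otimes> (s \<otimes>\<^bsub>S\<^esub> t)"
  unfolding current_lie_algebra_simps
  by (intro tensor_lift2_pure V.module_axioms S.module_axioms T.module_axioms
      bilinear_bracket_pure)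

lemma invariant_metric_current_iff:
  "invariant_metric K (current_lie_algebra K L S) C \<longleftrightarrow>
    bilinear_map K T T (self_module K) C \<and>
    (\<forall>u\<in>carrier T. \<forall>v\<in>carrier T. C u v = C v u) \<and>
    (\<forall>u\<in>carrier T. (\<forall>v\<in>carrier T. C u v = \<zero>) \<longrightarrow> u = \<zero>\<^bsub>T\<^esub>) \<and>
    (\<forall>u\<in>carrier T. \<forall>v\<in>carrier T. \<forall>w\<in>carrier T. C u (current_bracket v w) = C (current_bracket u v) w)"
  unfolding invariant_metric_def bilinear_map_current_lie_algebra
  by (simp add: current_lie_algebra_simps(1-2))

text \<open>\<open>twist_map \<alpha> s\<close> is the map written \<open>\<F>(s)\<close> in the statement.\<close>

definition twist_map where
  "twist_map \<alpha> s = tensor_lift K L (\<lambda>x t. \<alpha> s t x)"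

section \<open>The maps \<open>\<alpha> s t\<close>, their lifts to tensors and the radical of the
  form\<close>

context
  fixes \<alpha>
  assumes \<alpha>: "bilinear_map K S S (centroid K L) \<alpha>"
begin

lemma alpha_centroid: "\<lbrakk>s \<in> carrier S; t \<in> carrier S\<rbrakk> \<Longrightarrow> \<alpha> s t \<in> carrier (centroid K L)"
  by (rule bilinear_map_closed[OF \<alpha>])

lemma alpha_linear:
  shows "\<lbrakk>s \<in> carrier S; t \<in> carrier S\<rbrakk> \<Longrightarrow> linear_map K L L (\<alpha> s t)"
    and "\<lbrakk>s \<in> carrier S; x \<in> carrier L\<rbrakk> \<Longrightarrow> linear_map K S L (\<lambda>t. \<alpha> s t x)"
    and "\<lbrakk>t \<in> carrier S; x \<in> carrier L\<rbrakk> \<Longrightarrow> linear_map K S L (\<lambda>s. \<alpha> s t x)"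
  subgoal using alpha_centroid by (simp add: centroid_carrier)
  subgoal by (rule linear_map_comp[OF linear_map_centroid_eval bilinear_map_right[OF \<alpha>]])
  subgoal by (rule linear_map_comp[OF linear_map_centroid_eval bilinear_map_left[OF \<alpha>]])
  done

lemma alpha_closed:
  "\<lbrakk>s \<in> carrier S; t \<in> carrier S; x \<in> carrier L\<rbrakk> \<Longrightarrow> \<alpha> s t x \<in> carrier L"
  by (rule linear_map_closed[OF alpha_linear(1)])

lemma alpha_bracket:
  "\<lbrakk>s \<in> carrier S; t \<in> carrier S; x \<in> carrier L; y \<in> carrier L\<rbrakk> \<Longrightarrow>
    \<alpha> s t (bracket L x y) = bracket L (\<alpha> s t x) y"
  using alpha_centroid by (auto simp: centroid_carrier)

lemma bilinear_twist: "s \<in> carrier S \<Longrightarrow> bilinear_map K L S L (\<lambda>x t. \<alpha> s t x)"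
  by (simp add: bilinear_map_def alpha_linear(1,2))

lemma linear_map_twist: "s \<in> carrier S \<Longrightarrow> linear_map K T L (twist_map \<alpha> s)"
  unfolding twist_map_def
  by (rule linear_map_tensor_lift[OF V.module_axioms S.module_axioms V.module_axioms bilinear_twist])

lemma twist_pure:
  "\<lbrakk>s \<in> carrier S; x \<in> carrier L; t \<in> carrier S\<rbrakk> \<Longrightarrow> twist_map \<alpha> s (x \<otimes>\<otimes> t) = \<alpha> s t x"
  unfolding twist_map_def
  by (rule tensor_lift_pure[OF V.module_axioms S.module_axioms V.module_axioms bilinear_twist])

lemma twist_kernels_iff:
  "(\<Inter>s\<in>carrier S. a_kernel (current_lie_algebra K L S) L (tensor_lift K L (\<lambda>x t. \<alpha> s t x)))
      = {\<zero>\<^bsub>current_lie_algebra K L S\<^esub>} \<longleftrightarrow>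
    (\<forall>u\<in>carrier T. (\<forall>s\<in>carrier S. twist_map \<alpha> s u = \<zero>\<^bsub>L\<^esub>) \<longrightarrow> u = \<zero>\<^bsub>T\<^esub>)"
proof -
  have zero: "twist_map \<alpha> s \<zero>\<^bsub>T\<^esub> = \<zero>\<^bsub>L\<^esub>" if "s \<in> carrier S" for s
    by (rule linear_map_zero[OF T.module_axioms V.module_axioms linear_map_twist[OF that]])
  have "(\<Inter>s\<in>carrier S. a_kernel (current_lie_algebra K L S) L (tensor_lift K L (\<lambda>x t. \<alpha> s t x)))
      = {u \<in> carrier T. \<forall>s\<in>carrier S. twist_map \<alpha> s u = \<zero>\<^bsub>L\<^esub>}"
    \<comment> \<open>The index set must be non-empty: an intersection over no indices would be the
      whole type instead of a subset of \<open>carrier T\<close>.\<close>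
    using S.zero_closed
    by (auto simp: a_kernel_def' current_lie_algebra_simps(1) twist_map_def)
  then show ?thesis
    using zero by (auto simp: current_lie_algebra_simps(2))
qed

text \<open>With a pure second argument both sides are linear in \<open>u\<close>, so the
  prescription on pure tensors decides the equality.\<close>

lemma form_twist:
  assumes C: "bilinear_map K T T (self_module K) C"
    and C_pure: "\<And>x t y s. \<lbrakk>x \<in> carrier L; t \<in> carrier S; y \<in> carrier L; s \<in> carrier S\<rbrakk> \<Longrightarrow>
      C (x \<otimes>\<otimes> t) (y \<otimes>\<otimes> s) = B (\<alpha> s t x) y"
    and "u \<in> carrier T" "y \<in> carrier L" "s \<in> carrier S"
  shows "C u (y \<otimes>\<otimes> s) = B (twist_map \<alpha> s u) y"
  by (rule tensor_eqI[OF K.module_self_module bilinear_map_left[OF C]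
        linear_map_comp[OF form_left linear_map_twist]])
     (use assms in \<open>simp_all add: pure_closed twist_pure\<close>)

text \<open>From left to right, pure test tensors suffice and non-degeneracy of \<open>B\<close>
  removes the pairing with \<open>y\<close>. Conversely, the \<open>v\<close> orthogonal to
  \<open>u\<close> form a submodule containing all pure tensors. Both directions of the theorem rely
  on this.\<close>

lemma form_nondegenerate_iff:
  assumes C: "bilinear_map K T T (self_module K) C"
    and C_pure: "\<And>x t y s. \<lbrakk>x \<in> carrier L; t \<in> carrier S; y \<in> carrier L; s \<in> carrier S\<rbrakk> \<Longrightarrow>
      C (x \<otimes>\<otimes> t) (y \<otimes>\<otimes> s) = B (\<alpha> s t x) y"
    and u: "u \<in> carrier T"
  shows "(\<forall>v\<in>carrier T. C u v = \<zero>) \<longleftrightarrow> (\<forall>s\<in>carrier S. twist_map \<alpha> s u = \<zero>\<^bsub>L\<^esub>)"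
proof
  assume C0: "\<forall>v\<in>carrier T. C u v = \<zero>"
  show "\<forall>s\<in>carrier S. twist_map \<alpha> s u = \<zero>\<^bsub>L\<^esub>"
  proof
    fix s assume s: "s \<in> carrier S"
    show "twist_map \<alpha> s u = \<zero>\<^bsub>L\<^esub>"
    proof (rule form_nondegenerate)
      show "twist_map \<alpha> s u \<in> carrier L" by (rule linear_map_closed[OF linear_map_twist[OF s] u])
      show "B (twist_map \<alpha> s u) y = \<zero>" if y: "y \<in> carrier L" for y
        using C0 pure_closed[OF y s] form_twist[OF C C_pure u y s] by simp
    qed
  qed
next
  assume "\<forall>s\<in>carrier S. twist_map \<alpha> s u = \<zero>\<^bsub>L\<^esub>"
  then have pure: "C u (y \<otimes>\<otimes> s) = \<zero>" if "y \<in> carrier L" "s \<in> carrier S" for y s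
    using that form_twist[OF C C_pure u that] by (simp add: form_zero_left)
  show "\<forall>v\<in>carrier T. C u v = \<zero>"
  proof
    have "submodule {v \<in> carrier T. C u v = \<zero>} K T"
      using submodule_kernel[OF T.module_axioms K.module_self_module bilinear_map_right[OF C u]]
      by simp
    then show "C u v = \<zero>" if "v \<in> carrier T" for v
      using pure that by (rule tensor_induct[OF V.module_axioms S.module_axioms])
  qed
qed

lemma metric_of_alpha:
  assumes derived: "\<forall>x\<in>derived_algebra K L. \<forall>s\<in>carrier S. \<forall>t\<in>carrier S.
        \<alpha> s t x = \<alpha> (s \<otimes>\<^bsub>S\<^esub> t) \<one>\<^bsub>S\<^esub> x"
    and ker: "\<forall>u\<in>carrier T. (\<forall>s\<in>carrier S. twist_map \<alpha> s u = \<zero>\<^bsub>L\<^esub>) \<longrightarrow> u = \<zero>\<^bsub>T\<^esub>"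
    and adj: "\<forall>s\<in>carrier S. \<forall>t\<in>carrier S. form_adjoint K L B (\<alpha> s t) = \<alpha> t s"
  shows "\<exists>C. invariant_metric K (current_lie_algebra K L S) C"
proof -
  \<comment> \<open>The scalar of the second argument becomes the first index of
    \<open>\<alpha>\<close>, so that fixing a pure second argument leaves
    \<open>twist_map \<alpha> s\<close> acting on the first.\<close>
  define C where "C = tensor_lift2 K (self_module K) (\<lambda>x t y s. B (\<alpha> s t x) y)"
  have inner: "bilinear_map K L S (self_module K) (\<lambda>y s. B (\<alpha> s t x) y)"
    if "x \<in> carrier L" "t \<in> carrier S" for x t
    using that unfolding bilinear_map_def
    by (auto intro: form_right alpha_closed linear_map_comp[OF form_left alpha_linear(3)])
  have outer: "bilinear_map K L S (self_module K) (\<lambda>x t. B (\<alpha> s t x) y)"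
    if "y \<in> carrier L" "s \<in> carrier S" for y s
    using that unfolding bilinear_map_def
    by (auto intro: linear_map_comp[OF form_left alpha_linear(1)]
        linear_map_comp[OF form_left alpha_linear(2)])
  have C: "bilinear_map K T T (self_module K) C"
    unfolding C_def
    by (intro bilinear_map_tensor_lift2 V.module_axioms S.module_axioms K.module_self_module
        inner outer)
  have C_pure: "C (x \<otimes>\<otimes> t) (y \<otimes>\<otimes> s) = B (\<alpha> s t x) y"
    if "x \<in> carrier L" "t \<in> carrier S" "y \<in> carrier L" "s \<in> carrier S" for x t y s
    unfolding C_def
    by (intro tensor_lift2_pure V.module_axioms S.module_axioms K.module_self_module
        inner outer that)
  note left = bilinear_map_left[OF C] and right = bilinear_map_right[OF C]
    and br_left = bilinear_map_left[OF current_bracket_bilinear] and br_right = bilinear_map_right[OF current_bracket_bilinear]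
    and br_closed = bilinear_map_closed[OF current_bracket_bilinear]
    and eqI = tensor_eqI[OF K.module_self_module]
  have sym_pure: "C (x \<otimes>\<otimes> t) (y \<otimes>\<otimes> s) = C (y \<otimes>\<otimes> s) (x \<otimes>\<otimes> t)"
    if "x \<in> carrier L" "t \<in> carrier S" "y \<in> carrier L" "s \<in> carrier S" for x t y s
  proof -
    \<comment> \<open>Condition (iii) equates \<open>\<alpha> t s\<close> with a definite
      description; existence of adjoints in finite dimension turns this into an identity for
      \<open>B\<close>.\<close>
    have "B (\<alpha> s t x) y = B x (\<alpha> t s y)"
      using form_adjoint[OF fin_dim alpha_linear(1)[OF that(4,2)] that(1,3)] adj that by simp
    also have "\<dots> = B (\<alpha> t s y) x"
      using that by (intro form_sym alpha_closed)
    finally show ?thesis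
      using that by (simp add: C_pure)
  qed
  have sym: "C u v = C v u" if u: "u \<in> carrier T" and v: "v \<in> carrier T" for u v
  proof (rule eqI[OF left[OF v] right[OF v] _ u])
    fix x t assume xt: "x \<in> carrier L" "t \<in> carrier S"
    show "C (x \<otimes>\<otimes> t) v = C v (x \<otimes>\<otimes> t)"
      by (rule eqI[OF right left _ v]) (use xt in \<open>simp_all add: pure_closed sym_pure\<close>)
  qed
  have inv_pure: "C (x \<otimes>\<otimes> s) (current_bracket (y \<otimes>\<otimes> t) (z \<otimes>\<otimes> r)) = C (current_bracket (x \<otimes>\<otimes> s) (y \<otimes>\<otimes> t)) (z \<otimes>\<otimes> r)"
    if L: "x \<in> carrier L" "y \<in> carrier L" "z \<in> carrier L"
      and S: "s \<in> carrier S" "t \<in> carrier S" "r \<in> carrier S" for x y z s t r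
  proof -
    have xy: "bracket L x y \<in> derived_algebra K L"
      unfolding derived_algebra_def using L by (intro module_span_superset[THEN subsetD]) auto
    \<comment> \<open>Invariance of \<open>B\<close> moves the bracket to the left argument, and the
      centroid property pulls it inside \<open>\<alpha>\<close>, where condition (i) can act on
      it.\<close>
    have "B (\<alpha> (t \<otimes>\<^bsub>S\<^esub> r) s x) (bracket L y z) = B (\<alpha> (t \<otimes>\<^bsub>S\<^esub> r) s (bracket L x y)) z"
      using L S by (simp add: form_invariant alpha_closed alpha_bracket)
    \<comment> \<open>Condition (i) is used twice: here it merges both indices into one product, and
      below, read backwards, it splits that product as \<open>r\<close> and the product of
      \<open>s\<close> and \<open>t\<close>.\<close>
    also have "\<alpha> (t \<otimes>\<^bsub>S\<^esub> r) s (bracket L x y) = \<alpha> (t \<otimes>\<^bsub>S\<^esub> r \<otimes>\<^bsub>S\<^esub> s) \<one>\<^bsub>S\<^esub> (bracket L x y)"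
      by (rule derived[rule_format]) (use xy S in auto)
    also have "t \<otimes>\<^bsub>S\<^esub> r \<otimes>\<^bsub>S\<^esub> s = r \<otimes>\<^bsub>S\<^esub> (s \<otimes>\<^bsub>S\<^esub> t)"
      using S by (simp add: S.m_ac)
    also have "\<alpha> (r \<otimes>\<^bsub>S\<^esub> (s \<otimes>\<^bsub>S\<^esub> t)) \<one>\<^bsub>S\<^esub> (bracket L x y) = \<alpha> r (s \<otimes>\<^bsub>S\<^esub> t) (bracket L x y)"
      by (rule derived[rule_format, symmetric]) (use xy S in auto)
    finally show ?thesis
      using L S by (simp add: current_bracket_pure C_pure bracket_closed)
  qed
  \<comment> \<open>The three arguments are reduced to pure tensors in turn, the remaining ones
    being held fixed so that both sides are linear in the current one.\<close>
  have inv: "C u (current_bracket v w) = C (current_bracket u v) w"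
    if u: "u \<in> carrier T" and v: "v \<in> carrier T" and w: "w \<in> carrier T" for u v w
  proof (rule eqI[OF left[OF br_closed[OF v w]] linear_map_comp[OF left[OF w] br_left[OF v]] _ u])
    fix x s assume xs: "x \<in> carrier L" "s \<in> carrier S"
    note xs' = pure_closed[OF xs]
    show "C (x \<otimes>\<otimes> s) (current_bracket v w) = C (current_bracket (x \<otimes>\<otimes> s) v) w"
    proof (rule eqI[OF linear_map_comp[OF right[OF xs'] br_left[OF w]]
            linear_map_comp[OF left[OF w] br_right[OF xs']] _ v])
      fix y t assume yt: "y \<in> carrier L" "t \<in> carrier S"
      note yt' = pure_closed[OF yt]
      show "C (x \<otimes>\<otimes> s) (current_bracket (y \<otimes>\<otimes> t) w) = C (current_bracket (x \<otimes>\<otimes> s) (y \<otimes>\<otimes> t)) w"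
        by (rule eqI[OF linear_map_comp[OF right[OF xs'] br_right[OF yt']]
              right[OF br_closed[OF xs' yt']] _ w])
           (use xs yt inv_pure in auto)
    qed
  qed
  have "invariant_metric K (current_lie_algebra K L S) C"
    unfolding invariant_metric_current_iff
  proof (intro conjI ballI impI)
    show "u = \<zero>\<^bsub>T\<^esub>" if "u \<in> carrier T" "\<forall>v\<in>carrier T. C u v = \<zero>" for u
      using ker that form_nondegenerate_iff[OF C C_pure that(1)] by simp
  qed (fact C sym inv)+
  then show ?thesis by (rule exI[of _ C])
qed

end

text \<open>The algebraic properties of \<open>\<alpha>\<close> are tested by pairing with
  \<open>B\<close>, which turns them into properties of \<open>C\<close> on pure tensors;
  non-degeneracy of \<open>B\<close> then returns equalities of vectors.\<close>

lemma alpha_of_metric: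
  assumes "invariant_metric K (current_lie_algebra K L S) C"
  obtains \<alpha> where "bilinear_map K S S (centroid K L) \<alpha>"
    and "\<forall>x\<in>derived_algebra K L. \<forall>s\<in>carrier S. \<forall>t\<in>carrier S.
        \<alpha> s t x = \<alpha> (s \<otimes>\<^bsub>S\<^esub> t) \<one>\<^bsub>S\<^esub> x"
    and "\<forall>u\<in>carrier T. (\<forall>s\<in>carrier S. twist_map \<alpha> s u = \<zero>\<^bsub>L\<^esub>) \<longrightarrow> u = \<zero>\<^bsub>T\<^esub>"
    and "\<forall>s\<in>carrier S. \<forall>t\<in>carrier S. form_adjoint K L B (\<alpha> s t) = \<alpha> t s"
proof -
  note metric = assms[unfolded invariant_metric_current_iff]
  note C = metric[THEN conjunct1]
    and sym = metric[THEN conjunct2, THEN conjunct1, rule_format]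
    and nondeg = metric[THEN conjunct2, THEN conjunct2, THEN conjunct1, rule_format]
    and inv = metric[THEN conjunct2, THEN conjunct2, THEN conjunct2, rule_format]
  note left = bilinear_map_left[OF C] and right = bilinear_map_right[OF C]
    and pure_left = bilinear_map_left[OF pure_bilinear]
    and pure_right = bilinear_map_right[OF pure_bilinear]
  have "\<exists>A. A \<in> extensional (carrier L) \<and> linear_map K L L A \<and>
      (\<forall>x\<in>carrier L. \<forall>y\<in>carrier L. B (A x) y = C (x \<otimes>\<otimes> t) (y \<otimes>\<otimes> s))"
    if "s \<in> carrier S" "t \<in> carrier S" for s t
  proof (rule riesz_bilinear[OF fin_dim V.module_axioms])
    show "bilinear_map K L L (self_module K) (\<lambda>x y. C (x \<otimes>\<otimes> t) (y \<otimes>\<otimes> s))"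
      unfolding bilinear_map_def using that
      by (auto intro: pure_closed linear_map_comp[OF left pure_left]
          linear_map_comp[OF right pure_left])
  qed
  then obtain \<alpha> where \<alpha>: "\<And>s t. \<lbrakk>s \<in> carrier S; t \<in> carrier S\<rbrakk> \<Longrightarrow>
      \<alpha> s t \<in> extensional (carrier L) \<and> linear_map K L L (\<alpha> s t) \<and>
      (\<forall>x\<in>carrier L. \<forall>y\<in>carrier L. B (\<alpha> s t x) y = C (x \<otimes>\<otimes> t) (y \<otimes>\<otimes> s))"
    by metis
  have ext: "\<alpha> s t \<in> extensional (carrier L)" and lin: "linear_map K L L (\<alpha> s t)"
    if "s \<in> carrier S" "t \<in> carrier S" for s t
    using \<alpha> that by auto
  have closed: "\<alpha> s t x \<in> carrier L"
    if "s \<in> carrier S" "t \<in> carrier S" "x \<in> carrier L" for s t x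
    using linear_map_closed[OF lin] that .
  have C_pure: "B (\<alpha> s t x) y = C (x \<otimes>\<otimes> t) (y \<otimes>\<otimes> s)"
    if "s \<in> carrier S" "t \<in> carrier S" "x \<in> carrier L" "y \<in> carrier L" for s t x y
    using \<alpha>[OF that(1,2)] that(3,4) by blast
  have centroid: "\<alpha> s t (bracket L x y) = bracket L (\<alpha> s t x) y"
    if S: "s \<in> carrier S" "t \<in> carrier S" and L: "x \<in> carrier L" "y \<in> carrier L" for s t x y
  proof (rule form_eqI)
    fix z assume z: "z \<in> carrier L"
    \<comment> \<open>Giving \<open>y\<close> the unit keeps \<open>t\<close> with \<open>x\<close>
      and \<open>s\<close> with \<open>z\<close>, so the same map \<open>\<alpha> s t\<close>
      appears before and after the bracket is shifted.\<close>
    have "B (\<alpha> s t (bracket L x y)) z = C (current_bracket (x \<otimes>\<otimes> t) (y \<otimes>\<otimes> \<one>\<^bsub>S\<^esub>)) (z \<otimes>\<otimes> s)"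
      using S L z by (simp add: C_pure bracket_closed current_bracket_pure)
    also have "\<dots> = C (x \<otimes>\<otimes> t) (current_bracket (y \<otimes>\<otimes> \<one>\<^bsub>S\<^esub>) (z \<otimes>\<otimes> s))"
      using S L z by (simp add: inv pure_closed)
    also have "\<dots> = B (\<alpha> s t x) (bracket L y z)"
      using S L z by (simp add: C_pure bracket_closed current_bracket_pure)
    also have "\<dots> = B (bracket L (\<alpha> s t x) y) z"
      using S L z by (simp add: form_invariant closed)
    finally show "B (\<alpha> s t (bracket L x y)) z = B (bracket L (\<alpha> s t x) y) z" .
  qed (use S L in \<open>auto intro: closed bracket_closed\<close>)
  have cent: "\<alpha> s t \<in> carrier (centroid K L)" if "s \<in> carrier S" "t \<in> carrier S" for s t
    using that ext lin centroid by (simp add: centroid_carrier)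
  \<comment> \<open>The maps were chosen independently for each pair of scalars. Their pairings with
    \<open>B\<close> are values of \<open>C\<close>, which depend bilinearly on the scalars, so
    uniqueness forces bilinearity.\<close>
  have bilin: "bilinear_map K S S (centroid K L) \<alpha>"
    unfolding bilinear_map_def
  proof (intro conjI ballI linear_mapI)
    fix s t assume s: "s \<in> carrier S" and t: "t \<in> carrier S"
    show "\<alpha> s t \<in> carrier (centroid K L)" by (rule cent[OF s t])
    then show "\<alpha> s t \<in> carrier (centroid K L)" .
    fix a assume a: "a \<in> carrier K"
    show "\<alpha> s (a \<odot>\<^bsub>S\<^esub> t) = a \<odot>\<^bsub>centroid K L\<^esub> \<alpha> s t"
    proof (rule extensionalityI[of _ "carrier L"])
      show "\<alpha> s (a \<odot>\<^bsub>S\<^esub> t) x = (a \<odot>\<^bsub>centroid K L\<^esub> \<alpha> s t) x" if x: "x \<in> carrier L" for x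
        using s t a x
        by (intro form_eqI)
           (simp_all add: centroid_simps closed C_pure form_smult_left
            linear_map_smult[OF pure_right] linear_map_smult[OF left] pure_closed)
    qed (use s t a ext in \<open>simp_all add: centroid_simps\<close>)
    show "\<alpha> (a \<odot>\<^bsub>S\<^esub> s) t = a \<odot>\<^bsub>centroid K L\<^esub> \<alpha> s t"
    proof (rule extensionalityI[of _ "carrier L"])
      show "\<alpha> (a \<odot>\<^bsub>S\<^esub> s) t x = (a \<odot>\<^bsub>centroid K L\<^esub> \<alpha> s t) x" if x: "x \<in> carrier L" for x
        using s t a x
        by (intro form_eqI)
           (simp_all add: centroid_simps closed C_pure form_smult_left
            linear_map_smult[OF pure_right] linear_map_smult[OF right] pure_closed)
    qed (use s t a ext in \<open>simp_all add: centroid_simps\<close>)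
  next
    fix s t t' assume s: "s \<in> carrier S" and t: "t \<in> carrier S" "t' \<in> carrier S"
    show "\<alpha> s (t \<oplus>\<^bsub>S\<^esub> t') = \<alpha> s t \<oplus>\<^bsub>centroid K L\<^esub> \<alpha> s t'"
    proof (rule extensionalityI[of _ "carrier L"])
      show "\<alpha> s (t \<oplus>\<^bsub>S\<^esub> t') x = (\<alpha> s t \<oplus>\<^bsub>centroid K L\<^esub> \<alpha> s t') x" if x: "x \<in> carrier L" for x
        using s t x
        by (intro form_eqI)
           (simp_all add: centroid_simps closed C_pure form_add_left
            linear_map_add[OF pure_right] linear_map_add[OF left] pure_closed)
    qed (use s t ext in \<open>simp_all add: centroid_simps\<close>)
  next
    fix t s s' assume t: "t \<in> carrier S" and s: "s \<in> carrier S" "s' \<in> carrier S"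
    show "\<alpha> (s \<oplus>\<^bsub>S\<^esub> s') t = \<alpha> s t \<oplus>\<^bsub>centroid K L\<^esub> \<alpha> s' t"
    proof (rule extensionalityI[of _ "carrier L"])
      show "\<alpha> (s \<oplus>\<^bsub>S\<^esub> s') t x = (\<alpha> s t \<oplus>\<^bsub>centroid K L\<^esub> \<alpha> s' t) x" if x: "x \<in> carrier L" for x
        using s t x
        by (intro form_eqI)
           (simp_all add: centroid_simps closed C_pure form_add_left
            linear_map_add[OF pure_right] linear_map_add[OF right] pure_closed)
    qed (use s t ext in \<open>simp_all add: centroid_simps\<close>)
  qed
  have "\<alpha> s t x = \<alpha> (s \<otimes>\<^bsub>S\<^esub> t) \<one>\<^bsub>S\<^esub> x"
    if S: "s \<in> carrier S" "t \<in> carrier S" and x: "x \<in> derived_algebra K L" for s t x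
  proof -
    have br: "\<alpha> s t (bracket L y z) = \<alpha> (s \<otimes>\<^bsub>S\<^esub> t) \<one>\<^bsub>S\<^esub> (bracket L y z)"
      if L: "y \<in> carrier L" "z \<in> carrier L" for y z
    proof (rule form_eqI)
      fix w assume w: "w \<in> carrier L"
      \<comment> \<open>Here \<open>t\<close> is attached to \<open>z\<close> instead of
        \<open>y\<close>, so that shifting the bracket brings it next to \<open>s\<close>.\<close>
      have "B (\<alpha> s t (bracket L y z)) w = C (current_bracket (y \<otimes>\<otimes> \<one>\<^bsub>S\<^esub>) (z \<otimes>\<otimes> t)) (w \<otimes>\<otimes> s)"
        using S L w by (simp add: C_pure bracket_closed current_bracket_pure)
      also have "\<dots> = C (y \<otimes>\<otimes> \<one>\<^bsub>S\<^esub>) (current_bracket (z \<otimes>\<otimes> t) (w \<otimes>\<otimes> s))"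
        using S L w by (simp add: inv pure_closed)
      \<comment> \<open>Only the product of the two scalars enters a bracket of pure tensors, so
        \<open>t\<close> can pass from \<open>z\<close> to \<open>w\<close>.\<close>
      also have "\<dots> = C (y \<otimes>\<otimes> \<one>\<^bsub>S\<^esub>) (current_bracket (z \<otimes>\<otimes> \<one>\<^bsub>S\<^esub>) (w \<otimes>\<otimes> (s \<otimes>\<^bsub>S\<^esub> t)))"
        using S L w by (simp add: current_bracket_pure S.m_comm)
      also have "\<dots> = C (current_bracket (y \<otimes>\<otimes> \<one>\<^bsub>S\<^esub>) (z \<otimes>\<otimes> \<one>\<^bsub>S\<^esub>)) (w \<otimes>\<otimes> (s \<otimes>\<^bsub>S\<^esub> t))"
        using S L w by (simp add: inv pure_closed)
      also have "\<dots> = B (\<alpha> (s \<otimes>\<^bsub>S\<^esub> t) \<one>\<^bsub>S\<^esub> (bracket L y z)) w"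
        using S L w by (simp add: C_pure bracket_closed current_bracket_pure)
      finally show "B (\<alpha> s t (bracket L y z)) w = B (\<alpha> (s \<otimes>\<^bsub>S\<^esub> t) \<one>\<^bsub>S\<^esub> (bracket L y z)) w" .
    qed (use S L in \<open>auto intro: closed bracket_closed\<close>)
    \<comment> \<open>The derived algebra is a span, so agreement on brackets extends to it through
      the equalizer.\<close>
    have "derived_algebra K L \<subseteq> {x \<in> carrier L. \<alpha> s t x = \<alpha> (s \<otimes>\<^bsub>S\<^esub> t) \<one>\<^bsub>S\<^esub> x}"
      unfolding derived_algebra_def
      by (intro module_span_minimal submodule_equalizer[OF V.module_axioms V.module_axioms] lin)
         (use S br bracket_closed in auto)
    then show ?thesis using x by auto
  qed
  moreover have "u = \<zero>\<^bsub>T\<^esub>"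
    if "u \<in> carrier T" "\<forall>s\<in>carrier S. twist_map \<alpha> s u = \<zero>\<^bsub>L\<^esub>" for u
    using form_nondegenerate_iff[OF bilin C C_pure[symmetric] that(1)] that
    by (intro nondeg) simp_all
  moreover have "form_adjoint K L B (\<alpha> s t) = \<alpha> t s"
    if S: "s \<in> carrier S" "t \<in> carrier S" for s t
  proof (rule form_adjoint_eqI[OF ext lin])
    fix x y assume L: "x \<in> carrier L" "y \<in> carrier L"
    have "B (\<alpha> s t x) y = C (x \<otimes>\<otimes> t) (y \<otimes>\<otimes> s)"
      using S L by (simp add: C_pure)
    also have "\<dots> = C (y \<otimes>\<otimes> s) (x \<otimes>\<otimes> t)"
      using S L by (intro sym pure_closed)
    also have "\<dots> = B (\<alpha> t s y) x"
      using S L by (simp add: C_pure)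
    also have "\<dots> = B x (\<alpha> t s y)"
      using S L by (intro form_sym closed)
    finally show "B (\<alpha> s t x) y = B x (\<alpha> t s y)" .
  qed (use S in auto)
  ultimately show thesis using bilin by (intro that) auto
qed

end

theorem theorem1p2:
  fixes K :: "('k, 'r) ring_scheme"
    and L :: "('k, 'g, 'l) lie_algebra_scheme"
    and S :: "('k, 's, 'n) module_scheme"
    and B :: "'g \<Rightarrow> 'g \<Rightarrow> 'k"
  assumes "field K"
    and "characteristic_zero K"
    and "quadratic_lie_algebra K L B"
    and "finite_dimensional K L"
    and "algebra K S"
    and "finite_dimensional K S"
  shows "(\<exists>C. invariant_metric K (current_lie_algebra K L S) C) \<longleftrightarrow>
    (\<exists>\<alpha>. bilinear_map K S S (centroid K L) \<alpha> \<and>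
      (\<forall>x\<in>derived_algebra K L. \<forall>s\<in>carrier S. \<forall>t\<in>carrier S.
        \<alpha> s t x = \<alpha> (s \<otimes>\<^bsub>S\<^esub> t) \<one>\<^bsub>S\<^esub> x) \<and>
      (\<Inter>s\<in>carrier S. a_kernel (current_lie_algebra K L S) L
          (tensor_lift K L (\<lambda>x t. \<alpha> s t x))) = {\<zero>\<^bsub>current_lie_algebra K L S\<^esub>} \<and>
      (\<forall>s\<in>carrier S. \<forall>t\<in>carrier S. form_adjoint K L B (\<alpha> s t) = \<alpha> t s))"
proof -
  interpret Q: quadratic_lie_algebra K L B by fact
  interpret S: algebra K S by fact
  interpret current_algebra K L S B
  proof (unfold_locales)
    show "bilinear_map K L L (self_module K) B"
      using Q.metric by (simp add: invariant_metric_def)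
    show "B x y = B y x" if "x \<in> carrier L" "y \<in> carrier L" for x y
      using Q.metric that by (simp add: invariant_metric_def)
    show "x = \<zero>\<^bsub>L\<^esub>" if "x \<in> carrier L" "\<And>y. y \<in> carrier L \<Longrightarrow> B x y = \<zero>\<^bsub>K\<^esub>" for x
      using Q.metric that by (simp add: invariant_metric_def)
    show "B x (bracket L y z) = B (bracket L x y) z"
      if "x \<in> carrier L" "y \<in> carrier L" "z \<in> carrier L" for x y z
      using Q.metric that by (simp add: invariant_metric_def)
  qed (fact Q.bracket_bilinear assms(4))+
  show ?thesis (is "_ \<longleftrightarrow> ?rhs")
  proof
    assume "\<exists>C. invariant_metric K (current_lie_algebra K L S) C"
    then obtain C where "invariant_metric K (current_lie_algebra K L S) C" ..
    from alpha_of_metric[OF this] obtain \<alpha> where \<alpha>: "bilinear_map K S S (centroid K L) \<alpha>"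
      "\<forall>x\<in>derived_algebra K L. \<forall>s\<in>carrier S. \<forall>t\<in>carrier S.
        \<alpha> s t x = \<alpha> (s \<otimes>\<^bsub>S\<^esub> t) \<one>\<^bsub>S\<^esub> x"
      "\<forall>u\<in>carrier T. (\<forall>s\<in>carrier S. twist_map \<alpha> s u = \<zero>\<^bsub>L\<^esub>) \<longrightarrow> u = \<zero>\<^bsub>T\<^esub>"
      "\<forall>s\<in>carrier S. \<forall>t\<in>carrier S. form_adjoint K L B (\<alpha> s t) = \<alpha> t s" .
    then show "?rhs" by (intro exI[of _ \<alpha>] conjI twist_kernels_iff[THEN iffD2])
  next
    assume "?rhs"
    then obtain \<alpha> where \<alpha>: "bilinear_map K S S (centroid K L) \<alpha>"
      "\<forall>x\<in>derived_algebra K L. \<forall>s\<in>carrier S. \<forall>t\<in>carrier S.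
        \<alpha> s t x = \<alpha> (s \<otimes>\<^bsub>S\<^esub> t) \<one>\<^bsub>S\<^esub> x"
      "(\<Inter>s\<in>carrier S. a_kernel (current_lie_algebra K L S) L
          (tensor_lift K L (\<lambda>x t. \<alpha> s t x))) = {\<zero>\<^bsub>current_lie_algebra K L S\<^esub>}"
      "\<forall>s\<in>carrier S. \<forall>t\<in>carrier S. form_adjoint K L B (\<alpha> s t) = \<alpha> t s"
      by (elim exE conjE)
    show "\<exists>C. invariant_metric K (current_lie_algebra K L S) C"
      by (rule metric_of_alpha[OF \<alpha>(1,2) twist_kernels_iff[OF \<alpha>(1), THEN iffD1, OF \<alpha>(3)] \<alpha>(4)])
  qed
qed

end
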